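(* Let $n\ge 1$ and let $S\subset\mathbb{R}^n$ be the union of a finite (nonempty) family of $n$-dimensional convex compact polyhedra. The following assertions are equivalent: (i) $S$ is connected by analytic paths. (ii) There exists a polynomial map $f:\mathbb{R}^{n}\to\mathbb{R}^n$ such that $f(\overline{B}_{n})=S$.
   Context: $\overline{B}_m$ denotes the closed unit ball of $\mathbb{R}^m$ centered at the origin. A map $\mathbb{R}^m\to\mathbb{R}^n$ is polynomial if each of its components is a polynomial with real coefficients. A semialgebraic set $S\subset\mathbb{R}^n$ is connected by analytic paths if for each pair of points $p_1,p_2\in S$ there exists a (real) analytic path $\alpha:[0,1]\to S$ (i.e. a map that extends to a real analytic map on an open neighborhood of $[0,1]$ in $\mathbb{R}$ with values in $\mathbb{R}^n$) such that $\alpha(0)=p_1$ and $\alpha(1)=p_2$. *)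

theory Defs
  imports "HOL-Analysis.Analysis"
begin

(* The library's analytic_on concerns complex functions only.  Convergence of the power series
   on a whole neighbourhood of t forces a positive radius of convergence. *)
definition real_analytic_on :: "(real \<Rightarrow> 'a::real_normed_vector) \<Rightarrow> real set \<Rightarrow> bool"
    (infixl "(real'_analytic'_on)" 50)
  where "f real_analytic_on U \<longleftrightarrow>
    (\<forall>t\<in>U. \<exists>a. \<forall>\<^sub>F s in nhds t. (\<lambda>k. (s - t) ^ k *\<^sub>R a k) sums f s)"

(* As for the library's paths, only the values of g on the unit interval matter; the analytic
   extension need not agree with g elsewhere. *)
definition analytic_path :: "(real \<Rightarrow> 'a::real_normed_vector) \<Rightarrow> bool"
  where "analytic_path g \<longleftrightarrow>
    (\<exists>U h. open U \<and> {0..1} \<subseteq> U \<and> h real_analytic_on U \<and> (\<forall>t\<in>{0..1}. h t = g t))"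

definition connected_by_analytic_paths :: "'a::real_normed_vector set \<Rightarrow> bool"
  where "connected_by_analytic_paths S \<longleftrightarrow>
    (\<forall>p\<in>S. \<forall>q\<in>S. \<exists>g. analytic_path g \<and> path_image g \<subseteq> S \<and> pathstart g = p \<and> pathfinish g = q)"

end

theory Submission
  imports Defs
begin

text \<open>A polynomial map carries segments of the ball to polynomial, hence analytic, paths, so one
  direction only uses that the ball is convex. The other direction is constructive.

  Suppose that \<open>\<gamma>\<^sub>1, \<dots>, \<gamma>\<^sub>n\<close> are polynomial paths in \<open>\<real>\<^sup>n\<close> with the same starting
  point \<open>p\<close>. Since \<open>\<gamma>\<^sub>k(t) - p\<close> is divisible by \<open>t\<close>, the map sending \<open>x\<close> to
  \<open>\<Sum>\<^sub>k (x\<^sub>k\<^sup>2 / |x|\<^sup>2) \<gamma>\<^sub>k(|x|\<^sup>2)\<close> is polynomial. For \<open>|x|\<^sup>2 = t\<close> the weights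
  \<open>x\<^sub>k\<^sup>2 / t\<close> run through all convex weights, so the image of the ball is the union over \<open>t\<close> in
  \<open>[0,1]\<close> of the convex hulls of \<open>\<gamma>\<^sub>1(t), \<dots>, \<gamma>\<^sub>n(t)\<close>: the region swept by a moving simplex
  of dimension \<open>n - 1\<close> (\<open>sweep_eq_image_cball\<close>). It remains to make this moving simplex stay in
  \<open>S\<close> and reach every point of \<open>S\<close>.

  The motion is first built from continuous pieces and then replaced by polynomials. The
  replacement must be exact at the finitely many times at which the moving simplex touches the
  boundary of \<open>S\<close>. Interpolating Taylor polynomials at those times and applying Weierstrass to
  the remainder gives polynomial paths whose error is at most
  \<open>\<kappa> \<Prod>\<^sub>z |t - z|\<^sup>m\<close>, with \<open>\<kappa>\<close> and \<open>m\<close> prescribed (\<open>weighted_Weierstrass\<close>). Hence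
  every piece only has to tolerate errors of this kind (\<open>robust_path\<close>), and robust pieces can be
  concatenated (\<open>robustly_swept_trans\<close>). Three kinds of pieces suffice.

  A piece of the first kind travels inside one polyhedron. In the interior every small error is
  tolerated.

  A piece of the second kind travels from one polyhedron to another: all \<open>\<gamma>\<^sub>k\<close> follow the same
  analytic path of \<open>S\<close>. If its end points avoid all hyperplanes that bound the polyhedra, the
  affine functions that define these hyperplanes do not vanish identically along the path. By analyticity their absolute values are
  bounded below by \<open>c \<Prod>\<^sub>z |t - z|\<^sup>m\<close>. Therefore a perturbation of smaller size crosses none of
  the hyperplanes and remains in the polyhedra that contain the path
  (\<open>robustly_swept_analytic_path\<close>).

  Pieces of the third kind cover a polyhedron, which is a finite union of \<open>n\<close>-simplices. Such a
  simplex is in turn the union over its vertices \<open>v\<close> of the regions where the barycentric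
  coordinate of \<open>v\<close> is minimal. To cover one region, the moving simplex comes out to the facet opposite to \<open>v\<close>
  and retreats, shrinking towards a point near \<open>v\<close>. The perturbed motion still covers the
  region exactly: the displacement is small compared with the distance from the facet, so that Brouwer's theorem
  applies in a neighbourhood of each point of the region
  (\<open>robustly_swept_vertex_region\<close>).\<close>

section \<open>Local behaviour of real analytic functions\<close>

text \<open>The remainder is the shifted power series, which converges uniformly near \<open>t\<close> by
  comparison with a geometric series.\<close>
lemma power_series_Taylor_remainder:
  fixes a :: "nat \<Rightarrow> 'a::banach"
  assumes "\<forall>\<^sub>F s in nhds t. (\<lambda>k. (s - t) ^ k *\<^sub>R a k) sums f s"
  shows "\<exists>r. isCont r t \<and> r t = a m \<and>
    (\<forall>\<^sub>F s in nhds t. f s = (\<Sum>k<m. (s - t) ^ k *\<^sub>R a k) + (s - t) ^ m *\<^sub>R r s)"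
proof -
  obtain d where d: "d > 0" "\<And>s. dist s t < d \<Longrightarrow> (\<lambda>k. (s - t) ^ k *\<^sub>R a k) sums f s"
    using assms by (auto simp: eventually_nhds_metric)
  define r where "r s = (\<Sum>k. (s - t) ^ k *\<^sub>R a (k + m))" for s
  have sums: "(\<lambda>k. (s - t) ^ (k + m) *\<^sub>R a (k + m)) sums (f s - (\<Sum>k<m. (s - t) ^ k *\<^sub>R a k))"
    if "dist s t < d" for s
    using d(2)[OF that] sums_iff_shift[of "\<lambda>k. (s - t) ^ k *\<^sub>R a k" m] by (simp add: add.commute)
  have summ: "summable (\<lambda>k. (s - t) ^ k *\<^sub>R a (k + m))" if "dist s t < d" "s \<noteq> t" for s
  proof -
    have "summable (\<lambda>k. inverse ((s - t) ^ m) *\<^sub>R ((s - t) ^ (k + m) *\<^sub>R a (k + m)))"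
      by (rule summable_scaleR_right[OF sums_summable[OF sums[OF that(1)]]])
    moreover have "inverse ((s - t) ^ m) *\<^sub>R ((s - t) ^ (k + m) *\<^sub>R a (k + m)) = (s - t) ^ k *\<^sub>R a (k + m)" for k
      using that(2) by (simp add: power_add)
    ultimately show ?thesis
      by (simp only:)
  qed
  have r_t: "r t = a m"
    unfolding r_def using suminf_finite[of "{0}" "\<lambda>k. (t - t) ^ k *\<^sub>R a (k + m)"] by simp
  have fr: "f s = (\<Sum>k<m. (s - t) ^ k *\<^sub>R a k) + (s - t) ^ m *\<^sub>R r s" if "dist s t < d" for s
  proof (cases "s = t")
    case True
    have "(\<lambda>k. (t - t) ^ k *\<^sub>R a k) sums f t"
      using d(2)[of t] d(1) by simp
    moreover have "(\<lambda>k. (t - t) ^ k *\<^sub>R a k) sums a 0"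
      using sums_finite[of "{0}" "\<lambda>k. (t - t) ^ k *\<^sub>R a k"] by simp
    ultimately have "f t = a 0"
      by (rule sums_unique2)
    then show ?thesis
      using True r_t by (cases m) (auto simp: lessThan_Suc_eq_insert_0 sum.reindex)
  next
    case False
    have "(\<lambda>k. (s - t) ^ m *\<^sub>R ((s - t) ^ k *\<^sub>R a (k + m))) sums ((s - t) ^ m *\<^sub>R r s)"
      unfolding r_def by (intro sums_scaleR_right summable_sums summ that False)
    then have "(\<lambda>k. (s - t) ^ (k + m) *\<^sub>R a (k + m)) sums ((s - t) ^ m *\<^sub>R r s)"
      by (simp add: power_add mult.commute)
    from sums_unique2[OF sums[OF that] this] show ?thesis
      by (simp add: algebra_simps)
  qed
  have "isCont r t"
  proof -
    define x where "x = t + d / 2"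
    have x: "dist x t < d" "x \<noteq> t"
      using d(1) by (auto simp: x_def dist_real_def)
    have "(\<lambda>k. (x - t) ^ k *\<^sub>R a (k + m)) \<longlonglongrightarrow> 0"
      by (rule summable_LIMSEQ_zero[OF summ[OF x]])
    then have "Bseq (\<lambda>k. (x - t) ^ k *\<^sub>R a (k + m))"
      by (intro convergent_imp_Bseq convergentI)
    then obtain K where K: "\<And>k. norm ((x - t) ^ k *\<^sub>R a (k + m)) \<le> K"
      by (auto simp: Bseq_def)
    have bound: "norm ((s - t) ^ k *\<^sub>R a (k + m)) \<le> K * (1 / 2) ^ k" if "s \<in> cball t (d / 4)" for s k
    proof -
      have "\<bar>s - t\<bar> ^ k \<le> (d / 4) ^ k"
        using that by (intro power_mono) (auto simp: dist_real_def abs_minus_commute)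
      also have "\<dots> = (1 / 2) ^ k * (x - t) ^ k"
        by (simp add: x_def flip: power_mult_distrib)
      finally have "\<bar>s - t\<bar> ^ k * norm (a (k + m)) \<le> (1 / 2) ^ k * (x - t) ^ k * norm (a (k + m))"
        by (rule mult_right_mono) simp
      also have "\<dots> \<le> (1 / 2) ^ k * K"
        using K[of k] d(1) by (simp add: x_def power_abs)
      finally show ?thesis
        by (simp add: power_abs mult.commute)
    qed
    have "uniform_limit (cball t (d / 4)) (\<lambda>n s. \<Sum>k<n. (s - t) ^ k *\<^sub>R a (k + m)) r sequentially"
      unfolding r_def
      by (rule Weierstrass_m_test[OF bound]) (auto intro!: summable_mult summable_geometric)
    then have "continuous_on (cball t (d / 4)) r"
      by (rule uniform_limit_theorem[rotated])
        (auto intro!: always_eventually continuous_intros)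
    then show ?thesis
      by (rule continuous_on_interior) (use d(1) in \<open>simp add: interior_cball\<close>)
  qed
  moreover have "\<forall>\<^sub>F s in nhds t. f s = (\<Sum>k<m. (s - t) ^ k *\<^sub>R a k) + (s - t) ^ m *\<^sub>R r s"
    using fr d(1) by (auto simp: eventually_nhds_metric)
  ultimately show ?thesis
    using r_t by blast
qed

text \<open>If some coefficient of the expansion at \<open>t\<close> is nonzero, the first such coefficient dominates
  the values of the function near \<open>t\<close>.\<close>
lemma real_analytic_local_dichotomy:
  fixes g :: "real \<Rightarrow> real"
  assumes "g real_analytic_on U" "t \<in> U"
  shows "(\<forall>\<^sub>F s in nhds t. g s = 0) \<or>
    (\<exists>k c. c > 0 \<and> (\<forall>\<^sub>F s in nhds t. c * \<bar>s - t\<bar> ^ k \<le> \<bar>g s\<bar>))"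
proof -
  obtain a where a: "\<forall>\<^sub>F s in nhds t. (\<lambda>k. (s - t) ^ k *\<^sub>R a k) sums g s"
    using assms by (auto simp: real_analytic_on_def)
  show ?thesis
  proof (cases "\<forall>k. a k = 0")
    case True
    have "\<forall>\<^sub>F s in nhds t. g s = 0"
      using a by eventually_elim (use True in \<open>auto simp: sums_0 dest: sums_unique\<close>)
    then show ?thesis ..
  next
    case False
    define k where "k = (LEAST k. a k \<noteq> 0)"
    have k: "a k \<noteq> 0" "\<And>j. j < k \<Longrightarrow> a j = 0"
      using False LeastI_ex[of "\<lambda>k. a k \<noteq> 0"] not_less_Least[of _ "\<lambda>k. a k \<noteq> 0"]
      unfolding k_def by blast+
    obtain r where r: "isCont r t" "r t = a k"
      "\<forall>\<^sub>F s in nhds t. g s = (\<Sum>j<k. (s - t) ^ j *\<^sub>R a j) + (s - t) ^ k *\<^sub>R r s"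
      using power_series_Taylor_remainder[OF a] by blast
    have "(r \<longlongrightarrow> a k) (nhds t)"
      using r(1,2) tendsto_at_iff_tendsto_nhds[of r t] by (simp add: isCont_def)
    then have "((\<lambda>s. \<bar>r s\<bar>) \<longlongrightarrow> \<bar>a k\<bar>) (nhds t)"
      by (rule tendsto_rabs)
    then have "\<forall>\<^sub>F s in nhds t. \<bar>a k\<bar> / 2 < \<bar>r s\<bar>"
      by (rule order_tendstoD) (use k in simp)
    with r(3) have "\<forall>\<^sub>F s in nhds t. \<bar>a k\<bar> / 2 * \<bar>s - t\<bar> ^ k \<le> \<bar>g s\<bar>"
    proof eventually_elim
      case (elim s)
      then have "\<bar>g s\<bar> = \<bar>s - t\<bar> ^ k * \<bar>r s\<bar>"
        using k(2) by (simp add: abs_mult power_abs)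
      then show ?case
        using mult_left_mono[of "\<bar>a k\<bar> / 2" "\<bar>r s\<bar>" "\<bar>s - t\<bar> ^ k"] elim(2)
        by (simp add: mult.commute)
    qed
    then show ?thesis
      using k(1) by (intro disjI2 exI[of _ k] exI[of _ "\<bar>a k\<bar> / 2"]) simp
  qed
qed

lemma real_analytic_imp_isCont:
  fixes f :: "real \<Rightarrow> 'a::banach"
  assumes "f real_analytic_on U" "t \<in> U"
  shows "isCont f t"
proof -
  obtain a where "\<forall>\<^sub>F s in nhds t. (\<lambda>k. (s - t) ^ k *\<^sub>R a k) sums f s"
    using assms by (auto simp: real_analytic_on_def)
  from power_series_Taylor_remainder[OF this, of 0] obtain r
    where "isCont r t" and "\<forall>\<^sub>F s in nhds t. f s = r s"
    by auto
  then show ?thesis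
    by (simp add: isCont_cong)
qed

section \<open>Lower bounds by products of distances\<close>

text \<open>The size of the errors that are tolerated near a finite set of times. Cutting the distances off
  at 1 makes the weight decrease when points are added to \<open>Z\<close> or when \<open>m\<close> grows, so that
  finitely many tolerances always have a common lower bound of the same form.\<close>
definition zero_weight :: "real set \<Rightarrow> nat \<Rightarrow> real \<Rightarrow> real"
  where "zero_weight Z m t = (\<Prod>z\<in>Z. min 1 \<bar>t - z\<bar>) ^ m"

lemma zero_weight_prod_bounds:
  "0 \<le> (\<Prod>z\<in>Z. min 1 \<bar>t - z\<bar>)" "(\<Prod>z\<in>Z. min 1 \<bar>t - z\<bar>) \<le> (1::real)"
  by (auto intro!: prod_nonneg prod_le_1)

lemma zero_weight_nonneg: "0 \<le> zero_weight Z m t"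
  by (simp add: zero_weight_def zero_weight_prod_bounds)

lemma zero_weight_le_1: "zero_weight Z m t \<le> 1"
  by (simp add: zero_weight_def power_le_one zero_weight_prod_bounds)

lemma zero_weight_antimono:
  assumes "finite Z'" "Z \<subseteq> Z'" "m \<le> m'"
  shows "zero_weight Z' m' t \<le> zero_weight Z m t"
proof -
  have "(\<Prod>z\<in>Z'. min 1 \<bar>t - z\<bar>) \<le> (\<Prod>z\<in>Z. min 1 \<bar>t - z\<bar>)"
    using zero_weight_prod_bounds[where Z = Z] zero_weight_prod_bounds[where Z = "Z' - Z"] assms
    by (simp add: prod.subset_diff[OF assms(2,1)] mult_left_le_one_le)
  then have "zero_weight Z' m' t \<le> zero_weight Z m' t"
    unfolding zero_weight_def by (intro power_mono zero_weight_prod_bounds)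
  also have "\<dots> \<le> zero_weight Z m t"
    unfolding zero_weight_def using assms(3) by (intro power_decreasing zero_weight_prod_bounds)
  finally show ?thesis .
qed

lemma zero_weight_le_power:
  assumes "finite Z" "z \<in> Z" "k \<le> m"
  shows "zero_weight Z m t \<le> \<bar>t - z\<bar> ^ k"
proof -
  have "zero_weight Z m t \<le> zero_weight {z} k t"
    using assms by (intro zero_weight_antimono) auto
  also have "\<dots> \<le> \<bar>t - z\<bar> ^ k"
    by (auto simp: zero_weight_def intro!: power_mono)
  finally show ?thesis .
qed

text \<open>The identity theorem: the times near which \<open>g\<close> vanishes identically and those near which it
  does not both form open sets, and the interval is connected.\<close>
lemma real_analytic_not_locally_zero:
  fixes g :: "real \<Rightarrow> real"
  assumes g: "g real_analytic_on U" and U: "{a..b} \<subseteq> U" and "a \<le> b" "g a \<noteq> 0" and t: "t \<in> {a..b}"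
  shows "\<not> (\<forall>\<^sub>F s in nhds t. g s = 0)"
proof -
  define N where "N = {t. \<forall>\<^sub>F s in nhds t. g s = 0}"
  have open_N: "open N"
  proof -
    have "N = \<Union>{V. open V \<and> (\<forall>s\<in>V. g s = 0)}"
      by (auto simp: N_def eventually_nhds)
    then show ?thesis
      by auto
  qed
  have "\<exists>V. open V \<and> t \<in> V \<and> V \<inter> N = {}" if t: "t \<in> {a..b}" "t \<notin> N" for t
  proof -
    obtain k c where "c > 0" and ev: "\<forall>\<^sub>F s in nhds t. c * \<bar>s - t\<bar> ^ k \<le> \<bar>g s\<bar>"
      using real_analytic_local_dichotomy[OF g, of t] t U unfolding N_def by blast
    obtain V where V: "open V" "t \<in> V" "\<And>s. s \<in> V \<Longrightarrow> c * \<bar>s - t\<bar> ^ k \<le> \<bar>g s\<bar>"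
      using ev by (auto simp: eventually_nhds)
    have False if s: "s \<in> V" "s \<in> N" for s
    proof -
      have "\<forall>\<^sub>F x in at s. g x = 0"
        using s(2) by (auto simp: N_def eventually_at_filter elim: eventually_mono)
      moreover have "\<forall>\<^sub>F x in at s. x \<in> V - {t}"
        using V(1) s(1) t(2) s(2)
        by (intro eventually_at_in_open') auto
      ultimately have "\<forall>\<^sub>F x in at s. False"
      proof eventually_elim
        case (elim x)
        then have "c * \<bar>x - t\<bar> ^ k > 0"
          using \<open>c > 0\<close> by simp
        then show ?case
          using elim V(3)[of x] by simp
      qed
      then show False
        by simp
    qed
    then show ?thesis
      using V(1,2) by blast
  qed
  then have "\<forall>t\<in>{a..b} - N. \<exists>V. open V \<and> t \<in> V \<and> V \<inter> N = {}"
    by blast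
  then obtain V where V: "\<And>t. t \<in> {a..b} - N \<Longrightarrow> open (V t) \<and> t \<in> V t \<and> V t \<inter> N = {}"
    by metis
  define W where "W = (\<Union>t\<in>{a..b} - N. V t)"
  have "open W" "W \<inter> N = {}" "{a..b} - N \<subseteq> W"
    using V unfolding W_def by blast+
  moreover have "connected {a..b}"
    by simp
  moreover have "a \<in> W"
  proof -
    have "a \<notin> N"
      using assms(4) eventually_nhds_x_imp_x unfolding N_def by blast
    then show ?thesis
      using \<open>{a..b} - N \<subseteq> W\<close> \<open>a \<le> b\<close> by auto
  qed
  ultimately have "N \<inter> {a..b} = {}"
    using open_N connectedD[of "{a..b}" W N] \<open>a \<le> b\<close> by fastforce
  then show ?thesis
    using t by (auto simp: N_def)
qed

text \<open>Near each time \<open>t\<close> the function is at least a multiple of \<open>\<bar>s - t\<bar> ^ k\<close>. Finitely many of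
  these neighbourhoods cover the interval, and every factor of the weight is at most 1, so that
  the product over all centres is a lower bound on each neighbourhood. Keeping
  only those centres that are zeros of \<open>g\<close> makes \<open>Z\<close> avoid the end points.\<close>
lemma real_analytic_lower_bound:
  fixes g :: "real \<Rightarrow> real"
  assumes g: "g real_analytic_on U" and U: "{a..b} \<subseteq> U" and "a \<le> b" "g a \<noteq> 0" "g b \<noteq> 0"
  shows "\<exists>Z m c. finite Z \<and> Z \<subseteq> {a<..<b} \<and> c > 0 \<and> (\<forall>t\<in>{a..b}. c * zero_weight Z m t \<le> \<bar>g t\<bar>)"
proof -
  have "\<exists>V k c. open V \<and> t \<in> V \<and> c > 0 \<and> (g t \<noteq> 0 \<longrightarrow> k = 0) \<and> (\<forall>s\<in>V. c * \<bar>s - t\<bar> ^ k \<le> \<bar>g s\<bar>)"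
    if t: "t \<in> {a..b}" for t
  proof (cases "g t = 0")
    case True
    obtain k c where "c > 0" "\<forall>\<^sub>F s in nhds t. c * \<bar>s - t\<bar> ^ k \<le> \<bar>g s\<bar>"
      using real_analytic_local_dichotomy[OF g, of t] real_analytic_not_locally_zero[OF g U assms(3,4) t] t U
      by (metis subsetD)
    then show ?thesis
      using True by (auto simp: eventually_nhds)
  next
    case False
    have "isCont g t"
      using real_analytic_imp_isCont[OF g] t U by auto
    then have "((\<lambda>s. \<bar>g s\<bar>) \<longlongrightarrow> \<bar>g t\<bar>) (nhds t)"
      by (intro tendsto_rabs) (use tendsto_at_iff_tendsto_nhds[of g t] in \<open>simp add: isCont_def\<close>)
    then have "\<forall>\<^sub>F s in nhds t. \<bar>g t\<bar> / 2 < \<bar>g s\<bar>"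
      by (rule order_tendstoD) (use False in simp)
    then obtain V where "open V" "t \<in> V" "\<forall>s\<in>V. \<bar>g t\<bar> / 2 < \<bar>g s\<bar>"
      by (auto simp: eventually_nhds)
    then show ?thesis
      using False by (intro exI[of _ V] exI[of _ 0] exI[of _ "\<bar>g t\<bar> / 2"]) auto
  qed
  then obtain V k c where V: "\<And>t. t \<in> {a..b} \<Longrightarrow> open (V t) \<and> t \<in> V t \<and> c t > 0 \<and>
      (g t \<noteq> 0 \<longrightarrow> k t = (0::nat)) \<and> (\<forall>s\<in>V t. c t * \<bar>s - t\<bar> ^ k t \<le> \<bar>g s\<bar>)"
    by metis
  obtain T where T: "T \<subseteq> {a..b}" "finite T" "{a..b} \<subseteq> (\<Union>t\<in>T. V t)"
    using compactE_image[of "{a..b}" "{a..b}" V] V by (metis (no_types, lifting) UN_I compact_Icc subsetI)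
  then have "T \<noteq> {}"
    using \<open>a \<le> b\<close> by auto
  \<comment> \<open>At a centre with \<open>g t \<noteq> 0\<close> the exponent is 0, so that this centre can be left out.\<close>
  define Z where "Z = {t\<in>T. g t = 0}"
  define m where "m = Max (k ` T)"
  define c0 where "c0 = Min (c ` T)"
  have c0: "c0 > 0" "\<And>t. t \<in> T \<Longrightarrow> c0 \<le> c t"
    using T V \<open>T \<noteq> {}\<close> by (auto simp: c0_def)
  have "c0 * zero_weight Z m s \<le> \<bar>g s\<bar>" if s: "s \<in> {a..b}" for s
  proof -
    obtain t where t: "t \<in> T" "s \<in> V t"
      using T(3) s by blast
    have "zero_weight Z m s \<le> \<bar>s - t\<bar> ^ k t"
    proof (cases "g t = 0")
      case True
      then show ?thesis
        using t T(2) by (intro zero_weight_le_power) (auto simp: Z_def m_def)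
    next
      case False
      then show ?thesis
        using V[of t] t T(1) zero_weight_le_1 by auto
    qed
    then have "c0 * zero_weight Z m s \<le> c t * \<bar>s - t\<bar> ^ k t"
      using c0 t by (intro mult_mono) (auto intro: zero_weight_nonneg less_imp_le order_trans)
    also have "\<dots> \<le> \<bar>g s\<bar>"
      using V t T(1) by auto
    finally show ?thesis .
  qed
  moreover have "finite Z"
    using T by (simp add: Z_def)
  moreover have "Z \<subseteq> {a<..<b}"
    using T(1) assms(4,5) by (force simp: Z_def less_le)
  ultimately show ?thesis
    using c0(1) by blast
qed

section \<open>Polynomial approximation to high order at prescribed times\<close>

lemma real_polynomial_function_poly: "real_polynomial_function (poly p)"
proof (induction p)
  case 0
  then show ?case
    by (simp add: real_polynomial_function_eq poly_0[abs_def])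
next
  case (pCons a p)
  have "poly (pCons a p) = (\<lambda>x. a + x * poly p x)"
    by (simp add: fun_eq_iff)
  moreover have "real_polynomial_function (\<lambda>x::real. x)"
    by (simp add: real_polynomial_function_eq)
  ultimately show ?case
    using pCons.IH by (simp add: real_polynomial_function.intros)
qed

text \<open>A polynomial that does not vanish at \<open>z\<close> is invertible modulo every power of the
  linear factor at \<open>z\<close>; the inverse is improved by one order at a time.\<close>
lemma poly_inverse_mod_power:
  fixes w :: "'a::field poly"
  assumes "poly w z \<noteq> 0"
  shows "\<exists>v q. v * w = 1 + [:- z, 1:] ^ m * q"
proof (induction m)
  case 0
  have "0 * w = 1 + [:- z, 1:] ^ 0 * (- 1)"
    by simp
  then show ?case
    by blast
next
  case (Suc m)
  then obtain v q where vq: "v * w = 1 + [:- z, 1:] ^ m * q"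
    by blast
  define c where "c = - poly q z / poly w z"
  have "poly (q + smult c w) z = 0"
    using assms by (simp add: c_def)
  then obtain q' where q': "q + smult c w = [:- z, 1:] * q'"
    unfolding poly_eq_0_iff_dvd dvd_def by blast
  have "(v + smult c ([:- z, 1:] ^ m)) * w = 1 + [:- z, 1:] ^ m * (q + smult c w)"
    using vq by (simp add: algebra_simps)
  also have "\<dots> = 1 + [:- z, 1:] ^ Suc m * q'"
    by (simp only: q' power_Suc mult_ac)
  finally show ?case
    by blast
qed

text \<open>Taylor expansions of every order at \<open>z\<close> with a continuous, not necessarily smooth, remainder
  factor. This is all that the interpolation needs, and it holds for polynomials and for analytic
  functions.\<close>
definition has_jets :: "(real \<Rightarrow> 'a::real_normed_vector) \<Rightarrow> real \<Rightarrow> bool"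
  where "has_jets \<beta> z \<longleftrightarrow> (\<forall>m. \<exists>p r. polynomial_function p \<and> isCont r z \<and>
    (\<forall>\<^sub>F t in nhds z. \<beta> t = p t + (t - z) ^ m *\<^sub>R r t))"

lemma has_jets_cong:
  assumes "\<forall>\<^sub>F t in nhds z. \<beta> t = \<beta>' t" "has_jets \<beta> z"
  shows "has_jets \<beta>' z"
  unfolding has_jets_def
proof
  fix m
  obtain p r where "polynomial_function p" "isCont r z"
    "\<forall>\<^sub>F t in nhds z. \<beta> t = p t + (t - z) ^ m *\<^sub>R r t"
    using assms(2) unfolding has_jets_def by blast
  moreover from this(3) assms(1) have "\<forall>\<^sub>F t in nhds z. \<beta>' t = p t + (t - z) ^ m *\<^sub>R r t"
    by eventually_elim simp
  ultimately show "\<exists>p r. polynomial_function p \<and> isCont r z \<and>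
      (\<forall>\<^sub>F t in nhds z. \<beta>' t = p t + (t - z) ^ m *\<^sub>R r t)"
    by blast
qed

lemma has_jets_polynomial:
  assumes "polynomial_function \<beta>"
  shows "has_jets \<beta> z"
  unfolding has_jets_def
proof
  fix m
  show "\<exists>p r. polynomial_function p \<and> isCont r z \<and>
      (\<forall>\<^sub>F t in nhds z. \<beta> t = p t + (t - z) ^ m *\<^sub>R r t)"
    using assms by (intro exI[of _ \<beta>] exI[of _ "\<lambda>_. 0"]) simp
qed

text \<open>Induction on the set of nodes, as in the Chinese remainder theorem.\<close>
lemma Hermite_interpolation:
  fixes \<beta> :: "real \<Rightarrow> 'a::euclidean_space"
  assumes "finite Z" "\<And>z. z \<in> Z \<Longrightarrow> has_jets \<beta> z"
  shows "\<exists>T. polynomial_function T \<and>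
    (\<forall>z\<in>Z. \<exists>r. isCont r z \<and> (\<forall>\<^sub>F t in nhds z. \<beta> t = T t + (t - z) ^ m *\<^sub>R r t))"
  using assms
proof (induction Z)
  case empty
  show ?case
    by (intro exI[of _ "\<lambda>_. 0"]) simp
next
  case (insert z0 Z)
  obtain T where T: "polynomial_function T"
    "\<And>z. z \<in> Z \<Longrightarrow> \<exists>r. isCont r z \<and> (\<forall>\<^sub>F t in nhds z. \<beta> t = T t + (t - z) ^ m *\<^sub>R r t)"
    using insert by (metis insertCI)
  obtain b r0 where b: "polynomial_function b" "isCont r0 z0"
    "\<forall>\<^sub>F t in nhds z0. \<beta> t = b t + (t - z0) ^ m *\<^sub>R r0 t"
    using insert.prems unfolding has_jets_def by blast
  define w where "w = (\<Prod>z\<in>Z. [:- z, 1::real:] ^ m)"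
  have "poly w z0 \<noteq> 0"
    using insert.hyps by (auto simp: w_def poly_prod)
  then obtain v q where vq: "v * w = 1 + [:- z0, 1:] ^ m * q"
    using poly_inverse_mod_power by blast
  \<comment> \<open>The correction vanishes to order \<open>m\<close> on \<open>Z\<close>, because of the factor \<open>w\<close>, and turns
    the old interpolant into \<open>b\<close> to order \<open>m\<close> at the new node, because \<open>v * w\<close> is 1 there.\<close>
  define T' where "T' = (\<lambda>t. T t + poly (v * w) t *\<^sub>R (b t - T t))"
  have cont: "isCont b z" "isCont T z" "isCont (poly p) z" for z p
    using T b by (auto intro: continuous_polymonial_function)
  have T'_poly: "polynomial_function T'"
    unfolding T'_def using T(1) b(1) real_polynomial_function_poly[of "v * w"]
    by (intro polynomial_function_add polynomial_function_mult polynomial_function_diff)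
      (simp_all only: real_polynomial_function_eq)
  have "\<exists>r. isCont r z \<and> (\<forall>\<^sub>F t in nhds z. \<beta> t = T' t + (t - z) ^ m *\<^sub>R r t)" if "z \<in> insert z0 Z" for z
  proof (cases "z = z0")
    case True
    define r where "r t = r0 t - poly q t *\<^sub>R (b t - T t)" for t
    have "isCont r z0"
      unfolding r_def using b(2) cont by (intro continuous_intros)
    moreover have "\<forall>\<^sub>F t in nhds z0. \<beta> t = T' t + (t - z0) ^ m *\<^sub>R r t"
      using b(3)
    proof eventually_elim
      case (elim t)
      have "poly (v * w) t = 1 + (t - z0) ^ m * poly q t"
        unfolding vq by simp
      with elim show ?case
        by (simp add: T'_def r_def algebra_simps)
    qed
    ultimately show ?thesis
      using True by blast
  next
    case False
    then have z: "z \<in> Z"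
      using that by simp
    then obtain r1 where r1: "isCont r1 z" "\<forall>\<^sub>F t in nhds z. \<beta> t = T t + (t - z) ^ m *\<^sub>R r1 t"
      using T by blast
    define w' where "w' = v * (\<Prod>z\<in>Z - {z}. [:- z, 1::real:] ^ m)"
    have vw: "v * w = [:- z, 1:] ^ m * w'"
      using z insert.hyps by (simp add: w_def w'_def prod.remove mult.left_commute)
    define r where "r t = r1 t - poly w' t *\<^sub>R (b t - T t)" for t
    have "isCont r z"
      unfolding r_def using r1(1) cont by (intro continuous_intros)
    moreover have "\<forall>\<^sub>F t in nhds z. \<beta> t = T' t + (t - z) ^ m *\<^sub>R r t"
      using r1(2)
    proof eventually_elim
      case (elim t)
      have "poly (v * w) t = (t - z) ^ m * poly w' t"
        unfolding vw by simp
      with elim show ?case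
        by (simp add: T'_def r_def algebra_simps)
    qed
    ultimately show ?thesis
      by blast
  qed
  with T'_poly show ?case
    by blast
qed

text \<open>Subtract a Hermite interpolant and divide by the polynomial that vanishes to order \<open>m\<close> on
  \<open>Z\<close>. The quotient is continuous, and Weierstrass approximation of this quotient yields an error
  with the factor that was divided out. Adding a constant to the approximation makes it exact at
  \<open>a\<close>.\<close>
lemma weighted_Weierstrass:
  fixes \<beta> :: "real \<Rightarrow> 'a::euclidean_space"
  assumes "a < b" and cont: "continuous_on {a..b} \<beta>" and Z: "finite Z" "Z \<subseteq> {a..b}"
    and jets: "\<And>z. z \<in> Z \<Longrightarrow> has_jets \<beta> z" and "\<kappa> > 0"
  shows "\<exists>\<gamma>. polynomial_function \<gamma> \<and> \<gamma> a = \<beta> a \<and>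
    (\<forall>t\<in>{a..b}. dist (\<gamma> t) (\<beta> t) \<le> \<kappa> * zero_weight Z m t)"
proof -
  obtain T where T: "polynomial_function T"
    and rem: "\<forall>z\<in>Z. \<exists>r. isCont r z \<and> (\<forall>\<^sub>F t in nhds z. \<beta> t = T t + (t - z) ^ m *\<^sub>R r t)"
    using Hermite_interpolation[OF Z(1) jets, of m] by blast
  from bchoice[OF rem] obtain r where r: "\<And>z. z \<in> Z \<Longrightarrow> isCont (r z) z"
    "\<And>z. z \<in> Z \<Longrightarrow> \<forall>\<^sub>F t in nhds z. \<beta> t = T t + (t - z) ^ m *\<^sub>R r z t"
    by blast
  define W where "W X t = (\<Prod>z\<in>X. (t - z) ^ m)" for X and t :: real
  have W0: "W X t \<noteq> 0" if "finite X" "t \<notin> X" for X t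
    using that by (auto simp: W_def)
  have W_cont: "continuous (at t within A) (W X)" for X t A
    unfolding W_def by (intro continuous_intros)
  have W_poly: "real_polynomial_function (W X)" if "finite X" for X
    unfolding W_def using that
    by (intro real_polynomial_function_prod real_polynomial_function_power
        real_polynomial_function_diff) (auto simp: real_polynomial_function_eq)
  \<comment> \<open>Near \<open>z\<close> the quotient equals \<open>l z\<close>, which is continuous at \<open>z\<close>; its value at \<open>z\<close> fills the gap.\<close>
  define l where "l z t = (1 / W (Z - {z}) t) *\<^sub>R r z t" for z t
  define R where "R t = (if t \<in> Z then l t t else (1 / W Z t) *\<^sub>R (\<beta> t - T t))" for t
  have "continuous_on {a..b} R"
    unfolding continuous_on_eq_continuous_within
  proof
    fix t assume t: "t \<in> {a..b}"
    show "continuous (at t within {a..b}) R"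
    proof (cases "t \<in> Z")
      case True
      have "isCont (l t) t"
        unfolding l_def using r(1)[OF True] W_cont W0[of "Z - {t}" t] Z(1)
        by (intro continuous_intros) auto
      moreover have "\<forall>\<^sub>F s in nhds t. s \<in> - (Z - {t})"
        using Z(1) by (intro eventually_nhds_in_open open_Compl finite_imp_closed) auto
      with r(2)[OF True] have "\<forall>\<^sub>F s in nhds t. R s = l t s"
      proof eventually_elim
        case (elim s)
        show ?case
        proof (cases "s = t")
          case eq: True
          show ?thesis
            using True by (simp add: eq R_def)
        next
          case False
          have "W Z s = (s - t) ^ m * W (Z - {t}) s"
            using True Z(1) by (simp add: W_def prod.remove)
          moreover have "s \<notin> Z"
            using elim False by simp
          ultimately show ?thesis
            using elim False by (simp add: R_def l_def)
        qed
      qed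
      ultimately have "isCont R t"
        by (simp add: isCont_cong)
      then show ?thesis
        by (rule continuous_at_imp_continuous_at_within)
    next
      case False
      have "continuous (at t within {a..b}) (\<lambda>t. (1 / W Z t) *\<^sub>R (\<beta> t - T t))"
        using cont t W_cont W0[OF Z(1) False] continuous_polymonial_function[OF T]
        by (intro continuous_intros)
          (auto simp: continuous_on_eq_continuous_within intro: continuous_at_imp_continuous_at_within)
      then have "((\<lambda>t. (1 / W Z t) *\<^sub>R (\<beta> t - T t)) \<longlongrightarrow> R t) (at t within {a..b})"
        using False by (simp add: continuous_within R_def)
      moreover have "\<forall>\<^sub>F s in nhds t. s \<in> - Z"
        using Z(1) False by (intro eventually_nhds_in_open open_Compl finite_imp_closed) auto
      then have "\<forall>\<^sub>F s in at t within {a..b}. (1 / W Z s) *\<^sub>R (\<beta> s - T s) = R s"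
        unfolding eventually_at_filter by eventually_elim (simp add: R_def)
      ultimately show ?thesis
        unfolding continuous_within by (rule Lim_transform_eventually)
    qed
  qed
  have \<beta>: "\<beta> t = T t + W Z t *\<^sub>R R t" for t
  proof (cases "t \<in> Z")
    case True
    have "W Z t = (t - t) ^ m * W (Z - {t}) t"
      using True Z(1) by (simp add: W_def prod.remove)
    moreover have "\<beta> t = T t + (t - t) ^ m *\<^sub>R r t t"
      using r(2)[OF True] by (rule eventually_nhds_x_imp_x)
    ultimately show ?thesis
      using W0[of "Z - {t}" t] Z(1) True by (simp add: R_def l_def)
  next
    case False
    then show ?thesis
      using W0[OF Z(1) False] by (simp add: R_def)
  qed
  \<comment> \<open>\<open>K\<close> compares the distances on \<open>{a..b}\<close> with their truncations at 1.\<close>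
  define K where "K = (max 1 (b - a) ^ card Z) ^ m"
  have "K > 0"
    by (auto simp: K_def)
  obtain Q where Q: "polynomial_function Q" "\<And>t. t \<in> {a..b} \<Longrightarrow> norm (R t - Q t) < \<kappa> / (2 * K)"
    using Stone_Weierstrass_polynomial_function[OF compact_Icc \<open>continuous_on {a..b} R\<close>, of "\<kappa> / (2 * K)"]
      \<open>K > 0\<close> \<open>\<kappa> > 0\<close> by auto
  define \<gamma> where "\<gamma> t = T t + W Z t *\<^sub>R (Q t + (R a - Q a))" for t
  have "polynomial_function \<gamma>"
    unfolding \<gamma>_def using T Q(1) W_poly[OF Z(1)]
    by (intro polynomial_function_add polynomial_function_mult)
      (auto simp: real_polynomial_function_eq)
  moreover have "\<gamma> a = \<beta> a"
    using \<beta>[of a] by (simp add: \<gamma>_def)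
  moreover have "dist (\<gamma> t) (\<beta> t) \<le> \<kappa> * zero_weight Z m t" if t: "t \<in> {a..b}" for t
  proof -
    have "\<bar>t - z\<bar> \<le> max 1 (b - a) * min 1 \<bar>t - z\<bar>" if "z \<in> Z" for z
    proof (cases "\<bar>t - z\<bar> \<le> 1")
      case True
      then show ?thesis
        using mult_right_mono[of 1 "max 1 (b - a)" "\<bar>t - z\<bar>"] by simp
    next
      case False
      have "z \<in> {a..b}"
        using that Z(2) by blast
      then show ?thesis
        using False t by auto
    qed
    then have "(\<Prod>z\<in>Z. \<bar>t - z\<bar>) \<le> (\<Prod>z\<in>Z. max 1 (b - a) * min 1 \<bar>t - z\<bar>)"
      by (intro prod_mono) auto
    then have "(\<Prod>z\<in>Z. \<bar>t - z\<bar>) ^ m \<le> (\<Prod>z\<in>Z. max 1 (b - a) * min 1 \<bar>t - z\<bar>) ^ m"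
      by (intro power_mono prod_nonneg) auto
    also have "\<dots> = K * zero_weight Z m t"
      by (simp add: K_def zero_weight_def prod.distrib power_mult_distrib)
    also have "(\<Prod>z\<in>Z. \<bar>t - z\<bar>) ^ m = \<bar>W Z t\<bar>"
      by (simp add: W_def abs_prod prod_power_distrib power_abs)
    finally have W: "\<bar>W Z t\<bar> \<le> K * zero_weight Z m t" .
    have "norm (Q t + (R a - Q a) - R t) \<le> norm (R t - Q t) + norm (R a - Q a)"
      using norm_triangle_ineq4[of "R a - Q a" "R t - Q t"] by (simp add: algebra_simps)
    also have "\<dots> \<le> \<kappa> / (2 * K) + \<kappa> / (2 * K)"
      using Q(2)[OF t] Q(2)[of a] \<open>a < b\<close> by (intro add_mono less_imp_le) auto
    also have "\<dots> = \<kappa> / K"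
      by simp
    finally have "norm (Q t + (R a - Q a) - R t) \<le> \<kappa> / K" .
    then have "\<bar>W Z t\<bar> * norm (Q t + (R a - Q a) - R t) \<le> K * zero_weight Z m t * (\<kappa> / K)"
      using W \<open>K > 0\<close> by (intro mult_mono) (auto simp: zero_weight_nonneg)
    also have "\<dots> = \<kappa> * zero_weight Z m t"
      using \<open>K > 0\<close> by simp
    also have "\<bar>W Z t\<bar> * norm (Q t + (R a - Q a) - R t) = dist (\<gamma> t) (\<beta> t)"
    proof -
      have "\<gamma> t - \<beta> t = W Z t *\<^sub>R (Q t + (R a - Q a) - R t)"
        by (simp add: \<gamma>_def \<beta>[of t] algebra_simps)
      then show ?thesis
        by (simp add: dist_norm)
    qed
    finally show ?thesis .
  qed
  ultimately show ?thesis
    by blast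
qed

section \<open>Sweeps and their robustness\<close>

text \<open>The rows of the matrix \<open>\<gamma> t\<close> are the vertices of the moving simplex, and the sweep is the
  union of the convex hulls of the rows.\<close>
definition sweep :: "(real \<Rightarrow> 'a::real_vector ^ 'k) \<Rightarrow> real \<Rightarrow> real \<Rightarrow> 'a set"
  where "sweep \<gamma> a b =
    {(\<Sum>k\<in>UNIV. c k *\<^sub>R \<gamma> t $ k) | t c. t \<in> {a..b} \<and> (\<forall>k. 0 \<le> c k) \<and> sum c UNIV = 1}"

lemma sweepI:
  assumes "t \<in> {a..b}" "\<And>k. 0 \<le> c k" "sum c UNIV = 1" "y = (\<Sum>k\<in>UNIV. c k *\<^sub>R \<gamma> t $ k)"
  shows "y \<in> sweep \<gamma> a b"
  using assms unfolding sweep_def by blast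

lemma sweepE:
  assumes "y \<in> sweep \<gamma> a b"
  obtains t c where "t \<in> {a..b}" "\<And>k. 0 \<le> c k" "sum c UNIV = 1" "y = (\<Sum>k\<in>UNIV. c k *\<^sub>R \<gamma> t $ k)"
  using assms unfolding sweep_def by blast

lemma sweep_subset_convex:
  assumes "\<And>t. t \<in> {a..b} \<Longrightarrow> \<exists>P. convex P \<and> P \<subseteq> S \<and> (\<forall>k. \<gamma> t $ k \<in> P)"
  shows "sweep \<gamma> a b \<subseteq> S"
proof
  fix y assume "y \<in> sweep \<gamma> a b"
  then obtain t c where t: "t \<in> {a..b}" "\<And>k. 0 \<le> c k" "sum c UNIV = 1" "y = (\<Sum>k\<in>UNIV. c k *\<^sub>R \<gamma> t $ k)"
    by (rule sweepE) blast
  obtain P where "convex P" "P \<subseteq> S" "\<forall>k. \<gamma> t $ k \<in> P"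
    using assms[OF t(1)] by blast
  then show "y \<in> S"
    using t convex_sum[of UNIV P c "\<lambda>k. \<gamma> t $ k"] by auto
qed

lemma sweep_split:
  assumes "a \<le> b" "b \<le> c"
  shows "sweep \<gamma> a c = sweep \<gamma> a b \<union> sweep \<gamma> b c"
proof
  show "sweep \<gamma> a c \<subseteq> sweep \<gamma> a b \<union> sweep \<gamma> b c"
  proof
    fix y assume "y \<in> sweep \<gamma> a c"
    then obtain t l where t: "t \<in> {a..c}" "\<And>k. 0 \<le> l k" "sum l UNIV = 1" "y = (\<Sum>k\<in>UNIV. l k *\<^sub>R \<gamma> t $ k)"
      by (rule sweepE) blast
    show "y \<in> sweep \<gamma> a b \<union> sweep \<gamma> b c"
    proof (cases "t \<le> b")
      case True
      then have "y \<in> sweep \<gamma> a b"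
        using t by (intro sweepI[of t]) auto
      then show ?thesis ..
    next
      case False
      then have "y \<in> sweep \<gamma> b c"
        using t by (intro sweepI[of t]) auto
      then show ?thesis ..
    qed
  qed
next
  have "sweep \<gamma> u v \<subseteq> sweep \<gamma> a c" if "a \<le> u" "v \<le> c" for u v
  proof
    fix y assume "y \<in> sweep \<gamma> u v"
    then obtain t l where t: "t \<in> {u..v}" "\<And>k. 0 \<le> l k" "sum l UNIV = 1" "y = (\<Sum>k\<in>UNIV. l k *\<^sub>R \<gamma> t $ k)"
      by (rule sweepE) blast
    then show "y \<in> sweep \<gamma> a c"
      using that by (intro sweepI[of t]) auto
  qed
  then show "sweep \<gamma> a b \<union> sweep \<gamma> b c \<subseteq> sweep \<gamma> a c"
    using assms by simp
qed

text \<open>The points of \<open>Z\<close> are the times at which perturbations must agree with \<open>\<beta>\<close> to high order. They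
  avoid the end points, where a concatenation may destroy the expansions of \<open>\<beta>\<close>.\<close>
definition robust_path ::
    "'a::euclidean_space set \<Rightarrow> 'a set \<Rightarrow> (real \<Rightarrow> 'a ^ 'k) \<Rightarrow> real \<Rightarrow> real \<Rightarrow> bool"
  where "robust_path S C \<beta> a b \<longleftrightarrow> continuous_on {a..b} \<beta> \<and>
    (\<exists>Z m \<kappa>. finite Z \<and> Z \<subseteq> {a<..<b} \<and> (\<forall>z\<in>Z. has_jets \<beta> z) \<and> \<kappa> > 0 \<and>
      (\<forall>\<gamma>. continuous_on {a..b} \<gamma> \<longrightarrow>
        (\<forall>t\<in>{a..b}. dist (\<gamma> t) (\<beta> t) \<le> \<kappa> * zero_weight Z m t) \<longrightarrow>
        C \<subseteq> sweep \<gamma> a b \<and> sweep \<gamma> a b \<subseteq> S))"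

text \<open>Motions from the simplex \<open>A\<close> to the simplex \<open>B\<close>. Allowing every starting time makes
  concatenation possible without reparametrisation.\<close>
definition robustly_swept ::
    "'a::euclidean_space set \<Rightarrow> 'a ^ 'k \<Rightarrow> 'a ^ 'k \<Rightarrow> 'a set \<Rightarrow> bool"
  where "robustly_swept S A B C \<longleftrightarrow>
    (\<forall>a. \<exists>b \<beta>. a < b \<and> \<beta> a = A \<and> \<beta> b = B \<and> robust_path S C \<beta> a b)"

lemma robust_pathE:
  assumes "robust_path S C \<beta> a b"
  obtains Z m \<kappa> where "continuous_on {a..b} \<beta>" "finite Z" "Z \<subseteq> {a<..<b}"
    "\<And>z. z \<in> Z \<Longrightarrow> has_jets \<beta> z" "\<kappa> > 0"
    "\<And>\<gamma>. continuous_on {a..b} \<gamma> \<Longrightarrow>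
        (\<And>t. t \<in> {a..b} \<Longrightarrow> dist (\<gamma> t) (\<beta> t) \<le> \<kappa> * zero_weight Z m t) \<Longrightarrow>
        C \<subseteq> sweep \<gamma> a b \<and> sweep \<gamma> a b \<subseteq> S"
proof -
  obtain Z m \<kappa> where *: "finite Z" "Z \<subseteq> {a<..<b}" "\<forall>z\<in>Z. has_jets \<beta> z" "\<kappa> > 0"
    "\<forall>\<gamma>. continuous_on {a..b} \<gamma> \<longrightarrow>
        (\<forall>t\<in>{a..b}. dist (\<gamma> t) (\<beta> t) \<le> \<kappa> * zero_weight Z m t) \<longrightarrow>
        C \<subseteq> sweep \<gamma> a b \<and> sweep \<gamma> a b \<subseteq> S"
    and cont: "continuous_on {a..b} \<beta>"
    using assms unfolding robust_path_def by (elim conjE exE)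
  show thesis
  proof (rule that[OF cont *(1,2) _ *(4)])
    show "has_jets \<beta> z" if "z \<in> Z" for z
      using *(3) that by (rule bspec)
    show "C \<subseteq> sweep \<gamma> a b \<and> sweep \<gamma> a b \<subseteq> S" if "continuous_on {a..b} \<gamma>"
      "\<And>t. t \<in> {a..b} \<Longrightarrow> dist (\<gamma> t) (\<beta> t) \<le> \<kappa> * zero_weight Z m t" for \<gamma>
      using *(5) that by simp
  qed
qed

text \<open>The common tolerance is the minimum of the two scales with the weight of the union of the two
  sets of times. Since these times are interior to their intervals, the expansions there survive the
  gluing.\<close>
lemma robustly_swept_trans:
  assumes "robustly_swept S A B C" "robustly_swept S B D C'"
  shows "robustly_swept S A D (C \<union> C')"
  unfolding robustly_swept_def
proof
  fix a
  obtain b \<beta>1 where 1: "a < b" "\<beta>1 a = A" "\<beta>1 b = B" "robust_path S C \<beta>1 a b"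
    using assms(1) unfolding robustly_swept_def by blast
  obtain c \<beta>2 where 2: "b < c" "\<beta>2 b = B" "\<beta>2 c = D" "robust_path S C' \<beta>2 b c"
    using assms(2) unfolding robustly_swept_def by blast
  obtain Z1 m1 \<kappa>1 where Z1: "finite Z1" "Z1 \<subseteq> {a<..<b}" "\<And>z. z \<in> Z1 \<Longrightarrow> has_jets \<beta>1 z" "\<kappa>1 > 0"
    "\<And>\<gamma>. continuous_on {a..b} \<gamma> \<Longrightarrow>
        (\<And>t. t\<in>{a..b} \<Longrightarrow> dist (\<gamma> t) (\<beta>1 t) \<le> \<kappa>1 * zero_weight Z1 m1 t) \<Longrightarrow>
        C \<subseteq> sweep \<gamma> a b \<and> sweep \<gamma> a b \<subseteq> S"
    by (rule robust_pathE[OF 1(4)]) blast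
  obtain Z2 m2 \<kappa>2 where Z2: "finite Z2" "Z2 \<subseteq> {b<..<c}" "\<And>z. z \<in> Z2 \<Longrightarrow> has_jets \<beta>2 z" "\<kappa>2 > 0"
    "\<And>\<gamma>. continuous_on {b..c} \<gamma> \<Longrightarrow>
        (\<And>t. t\<in>{b..c} \<Longrightarrow> dist (\<gamma> t) (\<beta>2 t) \<le> \<kappa>2 * zero_weight Z2 m2 t) \<Longrightarrow>
        C' \<subseteq> sweep \<gamma> b c \<and> sweep \<gamma> b c \<subseteq> S"
    by (rule robust_pathE[OF 2(4)]) blast
  define \<beta> where "\<beta> t = (if t \<le> b then \<beta>1 t else \<beta>2 t)" for t
  define Z where "Z = Z1 \<union> Z2"
  define m where "m = max m1 m2"
  define \<kappa> where "\<kappa> = min \<kappa>1 \<kappa>2"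
  have "continuous_on ({a..b} \<union> {b..c}) \<beta>"
    unfolding \<beta>_def
    by (rule continuous_on_cases)
      (use 1 2 in \<open>auto simp: robust_path_def\<close>)
  moreover have ab: "{a..b} \<union> {b..c} = {a..c}"
    using 1(1) 2(1) by auto
  moreover have "has_jets \<beta> z" if "z \<in> Z" for z
  proof (cases "z \<in> Z1")
    case True
    then have "\<forall>\<^sub>F t in nhds z. t \<in> {..<b}"
      using Z1(2) by (intro eventually_nhds_in_open) auto
    then have "\<forall>\<^sub>F t in nhds z. \<beta>1 t = \<beta> t"
      by eventually_elim (simp add: \<beta>_def)
    then show ?thesis
      using Z1(3)[OF True] by (rule has_jets_cong)
  next
    case False
    then have z: "z \<in> Z2"
      using that by (simp add: Z_def)
    then have "\<forall>\<^sub>F t in nhds z. t \<in> {b<..}"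
      using Z2(2) by (intro eventually_nhds_in_open) auto
    then have "\<forall>\<^sub>F t in nhds z. \<beta>2 t = \<beta> t"
      by eventually_elim (simp add: \<beta>_def)
    then show ?thesis
      using Z2(3)[OF z] by (rule has_jets_cong)
  qed
  moreover have "C \<union> C' \<subseteq> sweep \<gamma> a c \<and> sweep \<gamma> a c \<subseteq> S"
    if \<gamma>: "continuous_on {a..c} \<gamma>" "\<forall>t\<in>{a..c}. dist (\<gamma> t) (\<beta> t) \<le> \<kappa> * zero_weight Z m t" for \<gamma>
  proof -
    have w: "\<kappa> * zero_weight Z m t \<le> \<kappa>1 * zero_weight Z1 m1 t"
      "\<kappa> * zero_weight Z m t \<le> \<kappa>2 * zero_weight Z2 m2 t" for t
      using Z1(1,4) Z2(1,4) unfolding Z_def m_def \<kappa>_def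
      by (intro mult_mono zero_weight_antimono zero_weight_nonneg; simp)+
    have "C \<subseteq> sweep \<gamma> a b \<and> sweep \<gamma> a b \<subseteq> S"
    proof (rule Z1(5))
      show "continuous_on {a..b} \<gamma>"
        using \<gamma>(1) by (rule continuous_on_subset) (use 2(1) in auto)
      show "dist (\<gamma> t) (\<beta>1 t) \<le> \<kappa>1 * zero_weight Z1 m1 t" if "t \<in> {a..b}" for t
        using bspec[OF \<gamma>(2), of t] w(1)[of t] that 2(1) by (auto simp: \<beta>_def)
    qed
    moreover have "C' \<subseteq> sweep \<gamma> b c \<and> sweep \<gamma> b c \<subseteq> S"
    proof (rule Z2(5))
      show "continuous_on {b..c} \<gamma>"
        using \<gamma>(1) by (rule continuous_on_subset) (use 1(1) in auto)
      show "dist (\<gamma> t) (\<beta>2 t) \<le> \<kappa>2 * zero_weight Z2 m2 t" if "t \<in> {b..c}" for t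
      proof -
        have "\<beta> t = \<beta>2 t"
          using that 1(3) 2(2) by (auto simp: \<beta>_def)
        then show ?thesis
          using bspec[OF \<gamma>(2), of t] w(2)[of t] that 1(1) by auto
      qed
    qed
    ultimately show ?thesis
      using sweep_split[of a b c \<gamma>] 1(1) 2(1) by auto
  qed
  moreover have "finite Z" "Z \<subseteq> {a<..<c}" "\<kappa> > 0"
    using Z1 Z2 1(1) 2(1) by (force simp: Z_def \<kappa>_def)+
  ultimately have "robust_path S (C \<union> C') \<beta> a c"
    unfolding robust_path_def ab by (intro conjI exI[of _ Z] exI[of _ m] exI[of _ \<kappa>]) blast+
  moreover have "\<beta> a = A" "\<beta> c = D" "a < c"
    using 1 2 by (auto simp: \<beta>_def)
  ultimately show "\<exists>c \<beta>. a < c \<and> \<beta> a = A \<and> \<beta> c = D \<and> robust_path S (C \<union> C') \<beta> a c"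
    by blast
qed

text \<open>A polynomial path within the tolerance exists by weighted approximation; a linear change of
  the parameter moves it to the unit interval.\<close>
lemma robustly_swept_polynomial:
  assumes "robustly_swept S A B C"
  obtains \<gamma> where "polynomial_function \<gamma>" "\<gamma> 0 = A" "C \<subseteq> sweep \<gamma> 0 1" "sweep \<gamma> 0 1 \<subseteq> S"
proof -
  obtain b \<beta> where 1: "0 < b" "\<beta> 0 = A" "robust_path S C \<beta> 0 b"
    using assms unfolding robustly_swept_def by blast
  obtain Z m \<kappa> where Z: "finite Z" "Z \<subseteq> {0<..<b}" "\<And>z. z \<in> Z \<Longrightarrow> has_jets \<beta> z" "\<kappa> > 0"
    "\<And>\<gamma>. continuous_on {0..b} \<gamma> \<Longrightarrow>
        (\<And>t. t\<in>{0..b} \<Longrightarrow> dist (\<gamma> t) (\<beta> t) \<le> \<kappa> * zero_weight Z m t) \<Longrightarrow>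
        C \<subseteq> sweep \<gamma> 0 b \<and> sweep \<gamma> 0 b \<subseteq> S"
    and cont: "continuous_on {0..b} \<beta>"
    by (rule robust_pathE[OF 1(3)]) blast
  obtain \<gamma> where \<gamma>: "polynomial_function \<gamma>" "\<gamma> 0 = \<beta> 0"
    "\<And>t. t\<in>{0..b} \<Longrightarrow> dist (\<gamma> t) (\<beta> t) \<le> \<kappa> * zero_weight Z m t"
    using weighted_Weierstrass[OF 1(1) cont Z(1) _ Z(3,4), of m] Z(2) by fastforce
  then have \<gamma>': "C \<subseteq> sweep \<gamma> 0 b \<and> sweep \<gamma> 0 b \<subseteq> S"
    by (intro Z(5) continuous_on_polymonial_function) auto
  define \<delta> where "\<delta> = \<gamma> \<circ> (\<lambda>t. b * t)"
  have "polynomial_function (\<lambda>t::real. b * t)"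
    by (simp add: polynomial_function_bounded_linear bounded_linear_mult_right)
  then have "polynomial_function \<delta>"
    unfolding \<delta>_def using \<gamma>(1) by (rule polynomial_function_compose)
  moreover have "sweep \<delta> 0 1 = sweep \<gamma> 0 b"
  proof
    show "sweep \<delta> 0 1 \<subseteq> sweep \<gamma> 0 b"
    proof
      fix y assume "y \<in> sweep \<delta> 0 1"
      then obtain t c where t: "t \<in> {0..1}" "\<And>k. 0 \<le> c k" "sum c UNIV = 1" "y = (\<Sum>k\<in>UNIV. c k *\<^sub>R \<delta> t $ k)"
        by (rule sweepE) blast
      then show "y \<in> sweep \<gamma> 0 b"
        using 1(1) by (intro sweepI[of "b * t" _ _ c]) (auto simp: \<delta>_def mult_left_le)
    qed
    show "sweep \<gamma> 0 b \<subseteq> sweep \<delta> 0 1"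
    proof
      fix y assume "y \<in> sweep \<gamma> 0 b"
      then obtain t c where t: "t \<in> {0..b}" "\<And>k. 0 \<le> c k" "sum c UNIV = 1" "y = (\<Sum>k\<in>UNIV. c k *\<^sub>R \<gamma> t $ k)"
        by (rule sweepE) blast
      then show "y \<in> sweep \<delta> 0 1"
        using 1(1) by (intro sweepI[of "t / b" _ _ c]) (auto simp: \<delta>_def)
    qed
  qed
  ultimately show thesis
    using that[of \<delta>] \<gamma>(2) \<gamma>' 1(2) by (simp add: \<delta>_def)
qed

lemma real_polynomial_factor_diff:
  fixes f :: "real \<Rightarrow> real"
  assumes "real_polynomial_function f"
  shows "\<exists>g. real_polynomial_function g \<and> (\<forall>t. f t = f 0 + t * g t)"
  using assms
proof (induction rule: real_polynomial_function.induct)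
  case (linear f)
  then have "f t = f 0 + t * f 1" for t
    using linear_cmul[OF bounded_linear.linear[OF linear], of t 1] linear_0[OF bounded_linear.linear[OF linear]]
    by simp
  moreover have "real_polynomial_function (\<lambda>_::real. f 1)"
    by (rule real_polynomial_function.intros)
  ultimately show ?case
    by blast
next
  case (const c)
  show ?case
    by (intro exI[of _ "\<lambda>_. 0"]) (auto intro: real_polynomial_function.intros)
next
  case (add f1 f2)
  then obtain g1 g2 where g: "real_polynomial_function g1" "\<And>t. f1 t = f1 0 + t * g1 t"
    "real_polynomial_function g2" "\<And>t. f2 t = f2 0 + t * g2 t"
    by blast
  have "f1 t + f2 t = f1 0 + f2 0 + t * (g1 t + g2 t)" for t
    using g(2)[of t] g(4)[of t] by (simp add: algebra_simps)
  moreover have "real_polynomial_function (\<lambda>t. g1 t + g2 t)"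
    by (intro real_polynomial_function.intros g)
  ultimately show ?case
    by blast
next
  case (mult f1 f2)
  then obtain g1 g2 where g: "real_polynomial_function g1" "\<And>t. f1 t = f1 0 + t * g1 t"
    "real_polynomial_function g2" "\<And>t. f2 t = f2 0 + t * g2 t"
    by blast
  have "f1 t * f2 t = f1 0 * f2 0 + t * (g1 t * f2 t + f1 0 * g2 t)" for t
    using g(2)[of t] g(4)[of t] by (simp add: algebra_simps)
  moreover have "real_polynomial_function (\<lambda>t. g1 t * f2 t + f1 0 * g2 t)"
    by (intro real_polynomial_function.intros g mult)
  ultimately show ?case
    by blast
qed

text \<open>Writing \<open>\<gamma> t $ k = p + t *\<^sub>R D t k\<close>, the map is
  \<open>f x = p + (\<Sum>k. (x $ k)\<^sup>2 *\<^sub>R D (x \<bullet> x) k)\<close>. For \<open>x \<noteq> 0\<close> this is the convex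
  combination of the rows at time \<open>x \<bullet> x\<close> with weights \<open>(x $ k)\<^sup>2 / (x \<bullet> x)\<close>. Conversely the
  combination with weights \<open>c k\<close> at time \<open>t\<close> is the value at the point with
  coordinates \<open>sqrt (t * c k)\<close>.\<close>
lemma sweep_eq_image_cball:
  fixes \<gamma> :: "real \<Rightarrow> (real ^ 'n) ^ 'n"
  assumes "polynomial_function \<gamma>" and \<gamma>0: "\<And>k. \<gamma> 0 $ k = p"
  shows "\<exists>f :: real ^ 'n \<Rightarrow> real ^ 'n. polynomial_function f \<and> f ` cball 0 1 = sweep \<gamma> 0 1"
proof -
  have "\<exists>g. real_polynomial_function g \<and> (\<forall>t. \<gamma> t $ k $ i = p $ i + t * g t)" for k i
  proof -
    have "bounded_linear (\<lambda>M::(real ^ 'n) ^ 'n. M $ k $ i)"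
      using bounded_linear_compose[OF bounded_linear_vec_nth bounded_linear_vec_nth] .
    then have "real_polynomial_function (\<lambda>t. \<gamma> t $ k $ i)"
      using assms(1) unfolding polynomial_function_def o_def by blast
    from real_polynomial_factor_diff[OF this] show ?thesis
      by (simp add: \<gamma>0)
  qed
  then have "\<forall>k. \<exists>G. \<forall>i. real_polynomial_function (G i) \<and> (\<forall>t. \<gamma> t $ k $ i = p $ i + t * G i t)"
    by (intro allI choice)
  from choice[OF this] obtain g where g: "\<And>k i. real_polynomial_function (g k i)"
    "\<And>k i t. \<gamma> t $ k $ i = p $ i + t * g k i t"
    by blast
  define D where "D t k = (\<chi> i. g k i t)" for t k
  have D: "\<gamma> t $ k = p + t *\<^sub>R D t k" for t k
    by (simp add: vec_eq_iff D_def g(2))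
  define f where "f x = p + (\<Sum>k\<in>UNIV. (x $ k)\<^sup>2 *\<^sub>R D (x \<bullet> x) k)" for x :: "real ^ 'n"
  have nth_poly: "real_polynomial_function (\<lambda>x::real^'n. x $ k)" for k
    by (simp add: real_polynomial_function_eq polynomial_function_bounded_linear bounded_linear_vec_nth)
  have "real_polynomial_function (\<lambda>x::real^'n. x \<bullet> x)"
    unfolding inner_vec_def using nth_poly
    by (auto intro!: real_polynomial_function_sum real_polynomial_function.intros(4))
  then have "real_polynomial_function (g k i \<circ> (\<lambda>x::real^'n. x \<bullet> x))" for k i
    using g(1) by (intro real_polynomial_function_compose) (simp_all add: real_polynomial_function_eq)
  then have *: "real_polynomial_function (\<lambda>x::real^'n. g k i (x \<bullet> x))" for k i
    by (simp add: o_def)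
  have f_nth: "f x $ i = p $ i + (\<Sum>k\<in>UNIV. (x $ k)\<^sup>2 * g k i (x \<bullet> x))" for x i
    by (simp add: f_def D_def)
  have "polynomial_function f"
    unfolding polynomial_function_iff_Basis_inner
  proof
    fix b :: "real ^ 'n" assume "b \<in> Basis"
    then obtain i where "b = axis i 1"
      by (auto simp: Basis_vec_def)
    then have "(\<lambda>x. f x \<bullet> b) = (\<lambda>x. p $ i + (\<Sum>k\<in>UNIV. (x $ k)\<^sup>2 * g k i (x \<bullet> x)))"
      by (simp add: fun_eq_iff inner_axis f_nth)
    then show "real_polynomial_function (\<lambda>x. f x \<bullet> b)"
      using * nth_poly
      by (auto intro!: real_polynomial_function.intros(2-) real_polynomial_function_sum
          real_polynomial_function_power)
  qed
  moreover have "f ` cball 0 1 = sweep \<gamma> 0 1"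
  proof
    show "f ` cball 0 1 \<subseteq> sweep \<gamma> 0 1"
    proof
      fix y assume "y \<in> f ` cball 0 1"
      then obtain x where x: "norm x \<le> 1" "y = f x"
        by auto
      show "y \<in> sweep \<gamma> 0 1"
      proof (cases "x = 0")
        case True
        show ?thesis
        proof (rule sweepI[of 0 _ _ "\<lambda>_. 1 / real CARD('n)"])
          show "y = (\<Sum>k\<in>UNIV. (1 / real CARD('n)) *\<^sub>R \<gamma> 0 $ k)"
            unfolding \<gamma>0 sum_constant_scaleR by (simp add: True x(2) f_def)
        qed simp_all
      next
        case False
        then have s: "x \<bullet> x > 0" "x \<bullet> x \<le> 1"
          using x(1) by (auto simp: dot_square_norm power_le_one)
        have sum: "(\<Sum>k\<in>UNIV. (x $ k)\<^sup>2) = x \<bullet> x"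
          by (simp add: inner_vec_def power2_eq_square)
        have "(\<Sum>k\<in>UNIV. ((x $ k)\<^sup>2 / (x \<bullet> x)) *\<^sub>R \<gamma> (x \<bullet> x) $ k) =
            (\<Sum>k\<in>UNIV. ((x $ k)\<^sup>2 / (x \<bullet> x)) *\<^sub>R p) + (\<Sum>k\<in>UNIV. (x $ k)\<^sup>2 *\<^sub>R D (x \<bullet> x) k)"
          using s(1) by (simp add: D scaleR_add_right sum.distrib)
        also have "(\<Sum>k\<in>UNIV. ((x $ k)\<^sup>2 / (x \<bullet> x)) *\<^sub>R p) = p"
          unfolding scaleR_sum_left[symmetric] sum_divide_distrib[symmetric] sum using s(1) by simp
        finally have "f x = (\<Sum>k\<in>UNIV. ((x $ k)\<^sup>2 / (x \<bullet> x)) *\<^sub>R \<gamma> (x \<bullet> x) $ k)"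
          by (simp add: f_def)
        then show ?thesis
          unfolding x(2)
        proof (rule sweepI[of "x \<bullet> x" _ _ "\<lambda>k. (x $ k)\<^sup>2 / (x \<bullet> x)", rotated 3])
          show "(\<Sum>k\<in>UNIV. (x $ k)\<^sup>2 / (x \<bullet> x)) = 1"
            unfolding sum_divide_distrib[symmetric] sum using s(1) by simp
        qed (use s in simp_all)
      qed
    qed
    show "sweep \<gamma> 0 1 \<subseteq> f ` cball 0 1"
    proof
      fix y assume "y \<in> sweep \<gamma> 0 1"
      then obtain t c where t: "t \<in> {0..1}" "\<And>k. 0 \<le> c k" "sum c UNIV = 1" "y = (\<Sum>k\<in>UNIV. c k *\<^sub>R \<gamma> t $ k)"
        by (rule sweepE) blast
      define x where "x = (\<chi> k. sqrt (t * c k))"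
      have x2: "(x $ k)\<^sup>2 = t * c k" for k
        using t by (simp add: x_def)
      have "x \<bullet> x = (\<Sum>k\<in>UNIV. (x $ k)\<^sup>2)"
        by (simp add: inner_vec_def power2_eq_square)
      also have "\<dots> = t * sum c UNIV"
        unfolding x2 sum_distrib_left ..
      finally have xx: "x \<bullet> x = t"
        by (simp add: t(3))
      have "y = (\<Sum>k\<in>UNIV. c k *\<^sub>R p) + (\<Sum>k\<in>UNIV. (t * c k) *\<^sub>R D t k)"
        unfolding t(4) D by (simp add: scaleR_add_right sum.distrib mult.commute[of t])
      also have "(\<Sum>k\<in>UNIV. c k *\<^sub>R p) = p"
        unfolding scaleR_sum_left[symmetric] t(3) by simp
      finally have "y = p + (\<Sum>k\<in>UNIV. (t * c k) *\<^sub>R D t k)" .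
      then have "y = f x"
        by (simp add: f_def x2 xx)
      moreover have "norm x \<le> 1"
        using t(1) xx by (simp add: norm_eq_sqrt_inner)
      ultimately show "y \<in> f ` cball 0 1"
        by (intro image_eqI[of _ _ x]) simp_all
    qed
  qed
  ultimately show ?thesis
    by (intro exI[of _ f] conjI)
qed

section \<open>Motions inside one polyhedron and along analytic paths\<close>

lemma dist_vec_nth: "dist (x $ i) (y $ i) \<le> dist x y" for x y :: "'a::real_normed_vector ^ 'n"
  using Finite_Cartesian_Product.norm_nth_le[of "x - y" i] by (simp add: dist_norm)

lemma robust_pathI_polynomial:
  assumes "polynomial_function \<beta>" "finite Z" "Z \<subseteq> {a<..<b}" "\<kappa> > 0"
    and "\<And>\<gamma>. continuous_on {a..b} \<gamma> \<Longrightarrow>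
      (\<And>t. t \<in> {a..b} \<Longrightarrow> dist (\<gamma> t) (\<beta> t) \<le> \<kappa> * zero_weight Z m t) \<Longrightarrow>
      C \<subseteq> sweep \<gamma> a b \<and> sweep \<gamma> a b \<subseteq> S"
  shows "robust_path S C \<beta> a b"
  unfolding robust_path_def
proof (intro conjI exI[of _ Z] exI[of _ m] exI[of _ \<kappa>])
  show "continuous_on {a..b} \<beta>"
    using assms(1) by (rule continuous_on_polymonial_function)
  show "\<forall>z\<in>Z. has_jets \<beta> z"
    using has_jets_polynomial[OF assms(1)] by blast
qed (use assms in simp_all)

text \<open>A compact subset of the interior of \<open>P\<close> has positive distance from the complement, so a
  constant tolerance suffices.\<close>
lemma robustly_swept_segment:
  fixes A B :: "'a::euclidean_space ^ 'k"
  assumes "convex P" "P \<subseteq> S" "\<And>k. A $ k \<in> interior P" "\<And>k. B $ k \<in> interior P"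
  shows "robustly_swept S A B {}"
  unfolding robustly_swept_def
proof
  fix a
  define \<beta> where "\<beta> t = A + (t - a) *\<^sub>R (B - A)" for t
  have poly: "polynomial_function \<beta>"
    unfolding \<beta>_def by (intro polynomial_function_add polynomial_function_mult polynomial_function_diff) auto
  define K where "K = (\<Union>k. (\<lambda>t. \<beta> t $ k) ` {a..a + 1})"
  have "continuous_on {a..a + 1} \<beta>"
    using poly by (rule continuous_on_polymonial_function)
  then have "continuous_on {a..a + 1} (\<lambda>t. \<beta> t $ k)" for k
    by (rule continuous_on_component)
  then have "compact K"
    unfolding K_def by (intro compact_UN compact_continuous_image) auto
  moreover have "\<beta> t $ k \<in> interior P" if "t \<in> {a..a + 1}" for t k
  proof -
    have "\<beta> t $ k = (1 - (t - a)) *\<^sub>R A $ k + (t - a) *\<^sub>R B $ k"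
      by (simp add: \<beta>_def algebra_simps)
    also have "\<dots> \<in> interior P"
      using that assms by (intro convexD_alt convex_interior) auto
    finally show ?thesis .
  qed
  then have "K \<subseteq> interior P"
    by (auto simp: K_def)
  ultimately obtain e where e: "e > 0" "\<And>x y. x \<in> K \<Longrightarrow> y \<notin> interior P \<Longrightarrow> e \<le> dist x y"
    using separate_compact_closed[of K "- interior P"] by (metis Compl_disjoint ComplI closed_Compl disjoint_eq_subset_Compl double_compl open_interior)
  have "robust_path S {} \<beta> a (a + 1)"
  proof (rule robust_pathI_polynomial[OF poly, where Z = "{}" and \<kappa> = "e / 2" and m = 0])
    fix \<gamma> assume \<gamma>: "\<And>t. t \<in> {a..a + 1} \<Longrightarrow> dist (\<gamma> t) (\<beta> t) \<le> e / 2 * zero_weight {} 0 t"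
    have "\<gamma> t $ k \<in> P" if "t \<in> {a..a + 1}" for t k
    proof -
      have "dist (\<beta> t $ k) (\<gamma> t $ k) < e"
        using \<gamma>[OF that] dist_vec_nth[of "\<gamma> t" k "\<beta> t"] e(1)
        by (simp add: zero_weight_def dist_commute)
      moreover have "\<beta> t $ k \<in> K"
        using that unfolding K_def by blast
      ultimately show ?thesis
        using e(2)[of "\<beta> t $ k" "\<gamma> t $ k"] interior_subset[of P] by force
    qed
    then have "sweep \<gamma> a (a + 1) \<subseteq> S"
      using assms(1,2) by (intro sweep_subset_convex) blast
    then show "{} \<subseteq> sweep \<gamma> a (a + 1) \<and> sweep \<gamma> a (a + 1) \<subseteq> S"
      by simp
  qed (use e in auto)
  moreover have "\<beta> a = A" "\<beta> (a + 1) = B"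
    by (simp_all add: \<beta>_def)
  ultimately show "\<exists>b \<beta>. a < b \<and> \<beta> a = A \<and> \<beta> b = B \<and> robust_path S {} \<beta> a b"
    by (intro exI[of _ "a + 1"] exI[of _ \<beta>]) simp
qed

text \<open>Together with the next two lemmas this gives the expansions of the path that moves all
  rows simultaneously along a time-shifted analytic path.\<close>
lemma has_jets_bounded_linear:
  assumes "bounded_linear f" "has_jets \<beta> z"
  shows "has_jets (\<lambda>t. f (\<beta> t)) z"
  unfolding has_jets_def
proof
  fix m
  interpret bounded_linear f by fact
  obtain p r where p: "polynomial_function p" "isCont r z"
    "\<forall>\<^sub>F t in nhds z. \<beta> t = p t + (t - z) ^ m *\<^sub>R r t"
    using assms(2) unfolding has_jets_def by blast
  have "\<forall>\<^sub>F t in nhds z. f (\<beta> t) = f (p t) + (t - z) ^ m *\<^sub>R f (r t)"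
    using p(3) by eventually_elim (simp add: add scaleR)
  moreover have "polynomial_function (f \<circ> p)"
    using p(1) polynomial_function_bounded_linear[OF assms(1)] by (rule polynomial_function_compose)
  moreover have "isCont (\<lambda>t. f (r t)) z"
    using p(2) by (rule isCont)
  ultimately show "\<exists>p r. polynomial_function p \<and> isCont r z \<and>
      (\<forall>\<^sub>F t in nhds z. f (\<beta> t) = p t + (t - z) ^ m *\<^sub>R r t)"
    unfolding o_def by blast
qed

lemma has_jets_shift:
  assumes "has_jets \<beta> z"
  shows "has_jets (\<lambda>t. \<beta> (t - c)) (z + c)"
  unfolding has_jets_def
proof
  fix m
  obtain p r where p: "polynomial_function p" "isCont r z"
    "\<forall>\<^sub>F t in nhds z. \<beta> t = p t + (t - z) ^ m *\<^sub>R r t"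
    using assms unfolding has_jets_def by blast
  have cont: "isCont (\<lambda>t. t - c) (z + c)"
    by (intro continuous_intros)
  then have "filterlim (\<lambda>t. t - c) (nhds z) (nhds (z + c))"
    using tendsto_at_iff_tendsto_nhds[of "\<lambda>t. t - c" "z + c"] by (simp add: isCont_def)
  from eventually_compose_filterlim[OF p(3) this]
  have "\<forall>\<^sub>F t in nhds (z + c). \<beta> (t - c) = p (t - c) + (t - (z + c)) ^ m *\<^sub>R r (t - c)"
    by eventually_elim (simp add: diff_diff_add add.commute)
  moreover have "polynomial_function (p \<circ> (\<lambda>t. t - c))"
    using p(1) by (intro polynomial_function_compose polynomial_function_diff) auto
  moreover have "isCont (\<lambda>t. r (t - c)) (z + c)"
    using isCont_o2[OF cont, of r] p(2) by simp
  ultimately show "\<exists>p r. polynomial_function p \<and> isCont r (z + c) \<and>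
      (\<forall>\<^sub>F t in nhds (z + c). \<beta> (t - c) = p t + (t - (z + c)) ^ m *\<^sub>R r t)"
    unfolding o_def by (intro exI conjI)
qed

lemma has_jets_real_analytic:
  fixes f :: "real \<Rightarrow> 'a::banach"
  assumes "f real_analytic_on U" "z \<in> U"
  shows "has_jets f z"
  unfolding has_jets_def
proof
  fix m
  obtain a where "\<forall>\<^sub>F s in nhds z. (\<lambda>k. (s - z) ^ k *\<^sub>R a k) sums f s"
    using assms by (auto simp: real_analytic_on_def)
  from power_series_Taylor_remainder[OF this, of m] obtain r
    where "isCont r z" and "\<forall>\<^sub>F s in nhds z. f s = (\<Sum>k<m. (s - z) ^ k *\<^sub>R a k) + (s - z) ^ m *\<^sub>R r s"
    by blast
  moreover have "real_polynomial_function (\<lambda>s. (s - z) ^ k)" for k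
    by (intro real_polynomial_function_power real_polynomial_function_diff)
      (simp_all add: real_polynomial_function_eq)
  then have "polynomial_function (\<lambda>s. \<Sum>k<m. (s - z) ^ k *\<^sub>R a k)"
    by (intro polynomial_function_sum polynomial_function_mult finite_lessThan)
      (simp_all add: real_polynomial_function_eq)
  ultimately show "\<exists>p r. polynomial_function p \<and> isCont r z \<and>
      (\<forall>\<^sub>F t in nhds z. f t = p t + (t - z) ^ m *\<^sub>R r t)"
    by (intro exI conjI)
qed

lemma real_analytic_on_inner_diff:
  fixes h :: "real \<Rightarrow> 'a::real_inner"
  assumes "h real_analytic_on U"
  shows "(\<lambda>t. c \<bullet> h t - d) real_analytic_on U"
  unfolding real_analytic_on_def
proof
  fix t assume "t \<in> U"
  then obtain a where a: "\<forall>\<^sub>F s in nhds t. (\<lambda>k. (s - t) ^ k *\<^sub>R a k) sums h s"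
    using assms by (auto simp: real_analytic_on_def)
  have "\<forall>\<^sub>F s in nhds t. (\<lambda>k. (s - t) ^ k *\<^sub>R (c \<bullet> a k - (if k = 0 then d else 0))) sums (c \<bullet> h s - d)"
    using a
  proof eventually_elim
    case (elim s)
    have "(\<lambda>k. c \<bullet> ((s - t) ^ k *\<^sub>R a k)) sums (c \<bullet> h s)"
      by (rule bounded_linear.sums[OF bounded_linear_inner_right elim])
    moreover have "(\<lambda>k. if k = 0 then d else 0) sums d"
      using sums_single[of 0 "\<lambda>_. d"] by simp
    ultimately have "(\<lambda>k. c \<bullet> ((s - t) ^ k *\<^sub>R a k) - (if k = 0 then d else 0)) sums (c \<bullet> h s - d)"
      by (rule sums_diff)
    moreover have "c \<bullet> ((s - t) ^ k *\<^sub>R a k) - (if k = 0 then d else 0) =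
        (s - t) ^ k *\<^sub>R (c \<bullet> a k - (if k = 0 then d else 0))" for k
      by (cases k) (auto simp: algebra_simps)
    ultimately show ?case
      by (simp only:)
  qed
  then show "\<exists>a. \<forall>\<^sub>F s in nhds t. (\<lambda>k. (s - t) ^ k *\<^sub>R a k) sums (c \<bullet> h s - d)"
    by (rule exI[of _ "\<lambda>k. c \<bullet> a k - (if k = 0 then d else 0)"])
qed

text \<open>Each affine function composed with \<open>h\<close> is analytic and nonzero at both ends. The lower
  bounds for the finitely many functions are combined into one.\<close>
lemma analytic_path_distance_to_hyperplanes:
  fixes h :: "real \<Rightarrow> 'a::real_inner"
  assumes h: "h real_analytic_on U" "{0..1} \<subseteq> U" and "finite H"
    and "\<And>c d. (c, d) \<in> H \<Longrightarrow> c \<bullet> h 0 \<noteq> d \<and> c \<bullet> h 1 \<noteq> d"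
  shows "\<exists>Z m e. finite Z \<and> Z \<subseteq> {0<..<1} \<and> e > 0 \<and>
    (\<forall>(c, d)\<in>H. \<forall>t\<in>{0..1}. e * zero_weight Z m t \<le> \<bar>c \<bullet> h t - d\<bar>)"
  using assms(3,4)
proof (induction H)
  case empty
  show ?case
    by (intro exI[of _ "{}"] exI[of _ 0] exI[of _ "1::real"]) auto
next
  case (insert p H)
  obtain c d where p: "p = (c, d)"
    by (cases p)
  have "c \<bullet> h 0 \<noteq> d \<and> c \<bullet> h 1 \<noteq> d" if "(c, d) \<in> H" for c d
    using insert.prems that by simp
  from insert.IH[OF this] obtain Z m e where Z: "finite Z" "Z \<subseteq> {0<..<1}" "e > 0"
    and dist: "\<forall>(c, d)\<in>H. \<forall>t\<in>{0..1}. e * zero_weight Z m t \<le> \<bar>c \<bullet> h t - d\<bar>"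
    by blast
  have "c \<bullet> h 0 - d \<noteq> 0" "c \<bullet> h 1 - d \<noteq> 0"
    using insert.prems[of c d] p by auto
  from real_analytic_lower_bound[OF real_analytic_on_inner_diff[OF h(1)] h(2) zero_le_one this]
  obtain Z' m' e' where Z': "finite Z'" "Z' \<subseteq> {0<..<1}" "e' > 0"
    "\<And>t. t \<in> {0..1} \<Longrightarrow> e' * zero_weight Z' m' t \<le> \<bar>c \<bullet> h t - d\<bar>"
    by blast
  have "min e e' * zero_weight (Z \<union> Z') (max m m') t \<le> e * zero_weight Z m t"
    "min e e' * zero_weight (Z \<union> Z') (max m m') t \<le> e' * zero_weight Z' m' t" for t
    using Z(1,3) Z'(1,3) by (intro mult_mono zero_weight_antimono zero_weight_nonneg; simp)+
  note le = this
  have "min e e' * zero_weight (Z \<union> Z') (max m m') t \<le> \<bar>c' \<bullet> h t - d'\<bar>"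
    if "(c', d') \<in> insert p H" "t \<in> {0..1}" for c' d' t
  proof (cases "(c', d') \<in> H")
    case True
    then have "e * zero_weight Z m t \<le> \<bar>c' \<bullet> h t - d'\<bar>"
      using dist that(2) by blast
    with le(1) show ?thesis
      by (rule order_trans)
  next
    case False
    then have "e' * zero_weight Z' m' t \<le> \<bar>c' \<bullet> h t - d'\<bar>"
      using Z'(4) p that by simp
    with le(2) show ?thesis
      by (rule order_trans)
  qed
  then have "\<forall>(c, d)\<in>insert p H. \<forall>t\<in>{0..1}.
      min e e' * zero_weight (Z \<union> Z') (max m m') t \<le> \<bar>c \<bullet> h t - d\<bar>"
    by blast
  then show ?case
    using Z Z' by (intro exI[of _ "Z \<union> Z'"] exI[of _ "max m m'"] exI[of _ "min e e'"]) simp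
qed

text \<open>At each time the path lies in one of the polyhedra of \<open>S\<close>. Every inequality that describes
  this polyhedron has a slack of at least \<open>e\<close> times the weight, which is at least the effect of the
  perturbation. So all perturbed rows lie in that same polyhedron, and by convexity so does
  their hull. Which polyhedron it is may change from one time to the next, even at a time
  when the path passes through a single common point of two of them.\<close>
lemma robustly_swept_analytic_path:
  fixes g :: "real \<Rightarrow> 'a::euclidean_space"
  assumes "analytic_path g" "path_image g \<subseteq> S" "finite H"
    and H: "\<And>c d. (c, d) \<in> H \<Longrightarrow> c \<bullet> pathstart g \<noteq> d \<and> c \<bullet> pathfinish g \<noteq> d"
    and S: "\<And>x. x \<in> S \<Longrightarrow> \<exists>G\<subseteq>H. (\<forall>(c, d)\<in>G. c \<bullet> x \<le> d) \<and> {y. \<forall>(c, d)\<in>G. c \<bullet> y \<le> d} \<subseteq> S"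
  shows "robustly_swept S (\<chi> k::'k::finite. pathstart g) (\<chi> k. pathfinish g) {}"
  unfolding robustly_swept_def
proof
  fix a
  obtain U h where h: "open U" "{0..1} \<subseteq> U" "h real_analytic_on U" "\<And>t. t \<in> {0..1} \<Longrightarrow> h t = g t"
    using assms(1) unfolding analytic_path_def by blast
  have hS: "h t \<in> S" if "t \<in> {0..1}" for t
    using that h(4) assms(2) by (auto simp: path_image_def)
  have "h 0 = pathstart g" "h 1 = pathfinish g"
    using h(4) by (auto simp: pathstart_def pathfinish_def)
  then have "c \<bullet> h 0 \<noteq> d \<and> c \<bullet> h 1 \<noteq> d" if "(c, d) \<in> H" for c d
    using H[OF that] by simp
  from analytic_path_distance_to_hyperplanes[OF h(3,2) assms(3) this]
  obtain Z m e where Z: "finite Z" "Z \<subseteq> {0<..<1}" "e > 0"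
    and dist: "\<forall>(c, d)\<in>H. \<forall>t\<in>{0..1}. e * zero_weight Z m t \<le> \<bar>c \<bullet> h t - d\<bar>"
    by blast
  define \<beta> where "\<beta> t = (\<chi> k::'k. h (t - a))" for t
  define Y where "Y = (\<lambda>z. z + a) ` Z"
  have Y_weight: "zero_weight Y m t = zero_weight Z m (t - a)" for t
    by (simp add: zero_weight_def Y_def prod.reindex diff_diff_add add.commute)
  define M where "M = 1 + (\<Sum>(c, d)\<in>H. norm c)"
  have "(\<Sum>(c, d)\<in>H. norm c) \<ge> 0"
    by (intro sum_nonneg) auto
  then have "M > 0"
    by (simp add: M_def)
  have M: "norm c \<le> M" if "(c, d) \<in> H" for c d
    using member_le_sum[of "(c, d)" H "\<lambda>(c, d). norm c"] that assms(3) by (auto simp: M_def)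
  have diag: "bounded_linear (\<lambda>x::'a. \<chi> k::'k. x)"
    by (intro linear_conv_bounded_linear[THEN iffD1] linearI) (simp_all add: vec_eq_iff)
  have "robust_path S {} \<beta> a (a + 1)"
    unfolding robust_path_def
  proof (intro conjI exI[of _ Y] exI[of _ m] exI[of _ "e / M"] allI impI ballI)
    have "continuous_on {0..1} h"
      using h(2) real_analytic_imp_isCont[OF h(3)] by (intro continuous_at_imp_continuous_on) auto
    then have "continuous_on {a..a + 1} (\<lambda>t. h (t - a))"
      by (rule continuous_on_compose2) (auto intro!: continuous_intros)
    then show "continuous_on {a..a + 1} \<beta>"
      unfolding \<beta>_def by (intro continuous_on_vec_lambda)
    show "has_jets \<beta> z" if z: "z \<in> Y" for z
    proof -
      obtain y where y: "y \<in> Z" "z = y + a"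
        using z by (auto simp: Y_def)
      have "{0<..<1::real} \<subseteq> {0..1}"
        by auto
      then have "y \<in> U"
        using h(2) Z(2) y(1) by blast
      then have "has_jets h y"
        by (rule has_jets_real_analytic[OF h(3)])
      then show ?thesis
        unfolding \<beta>_def y(2) by (intro has_jets_bounded_linear[OF diag] has_jets_shift)
    qed
    fix \<gamma> assume \<gamma>: "\<forall>t\<in>{a..a + 1}. dist (\<gamma> t) (\<beta> t) \<le> e / M * zero_weight Y m t"
    show "sweep \<gamma> a (a + 1) \<subseteq> S"
    proof (rule sweep_subset_convex)
      fix t assume t: "t \<in> {a..a + 1}"
      then have t': "t - a \<in> {0..1}"
        by auto
      obtain G where G: "G \<subseteq> H" "\<forall>(c, d)\<in>G. c \<bullet> h (t - a) \<le> d"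
        "{y. \<forall>(c, d)\<in>G. c \<bullet> y \<le> d} \<subseteq> S"
        using S[OF hS[OF t']] by blast
      have "c \<bullet> \<gamma> t $ k \<le> d" if cd: "(c, d) \<in> G" for c d k
      proof -
        have "dist (\<gamma> t $ k) (h (t - a)) \<le> e / M * zero_weight Y m t"
          using dist_vec_nth[of "\<gamma> t" k "\<beta> t"] bspec[OF \<gamma> t] by (simp add: \<beta>_def)
        then have "norm c * norm (\<gamma> t $ k - h (t - a)) \<le> M * (e / M * zero_weight Y m t)"
          using M[of c d] cd G(1) \<open>M > 0\<close> by (intro mult_mono) (auto simp: dist_norm)
        also have "\<dots> = e * zero_weight Z m (t - a)"
          using \<open>M > 0\<close> by (simp add: Y_weight)
        also have "\<dots> \<le> \<bar>c \<bullet> h (t - a) - d\<bar>"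
          using bspec[OF dist, of "(c, d)"] t' cd G(1) by auto
        also have "\<dots> = d - c \<bullet> h (t - a)"
          using bspec[OF G(2) cd] by simp
        finally have "c \<bullet> (\<gamma> t $ k - h (t - a)) \<le> d - c \<bullet> h (t - a)"
          using norm_cauchy_schwarz[of c "\<gamma> t $ k - h (t - a)"] by linarith
        then show ?thesis
          by (simp add: inner_diff_right)
      qed
      moreover have "convex {y. \<forall>(c, d)\<in>G. c \<bullet> y \<le> d}"
      proof -
        have "{y. \<forall>(c, d)\<in>G. c \<bullet> y \<le> d} = (\<Inter>(c, d)\<in>G. {y. c \<bullet> y \<le> d})"
          by auto
        then show ?thesis
          by (auto intro!: convex_INT convex_halfspace_le)
      qed
      ultimately show "\<exists>P. convex P \<and> P \<subseteq> S \<and> (\<forall>k. \<gamma> t $ k \<in> P)"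
        using G(3) by blast
    qed
  qed (use Z \<open>M > 0\<close> in \<open>auto simp: Y_def\<close>)
  moreover have "\<beta> a = (\<chi> k. pathstart g)" "\<beta> (a + 1) = (\<chi> k. pathfinish g)"
    using h(4) by (simp_all add: \<beta>_def pathstart_def pathfinish_def)
  ultimately show "\<exists>b \<beta>. a < b \<and> \<beta> a = (\<chi> k::'k. pathstart g) \<and> \<beta> b = (\<chi> k. pathfinish g) \<and>
      robust_path S {} \<beta> a b"
    by (intro exI[of _ "a + 1"] exI[of _ \<beta>]) simp
qed

section \<open>Covering a simplex\<close>

lemma vertex_coordinates_in_convex:
  fixes v :: "'a::real_vector" and V :: "'k::finite \<Rightarrow> 'a"
  assumes "convex P" "v \<in> P" "\<And>k. V k \<in> P" "\<And>k. 0 \<le> \<xi> k" "sum \<xi> UNIV \<le> 1"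
  shows "v + (\<Sum>k\<in>UNIV. \<xi> k *\<^sub>R (V k - v)) \<in> P"
proof -
  have UNIV_eq: "(UNIV :: 'k option set) = insert None (Some ` UNIV)"
    by (rule UNIV_option_conv)
  define c where "c = (\<lambda>i. case i of None \<Rightarrow> 1 - sum \<xi> UNIV | Some k \<Rightarrow> \<xi> k)"
  define y where "y = (\<lambda>i. case i of None \<Rightarrow> v | Some k \<Rightarrow> V k)"
  have "(\<Sum>i\<in>UNIV. c i *\<^sub>R y i) \<in> P"
  proof (rule convex_sum[OF _ assms(1)])
    show "sum c UNIV = 1"
      unfolding UNIV_eq by (simp add: sum.reindex c_def)
    show "c i \<ge> 0" "y i \<in> P" for i
      using assms by (cases i; simp add: c_def y_def)+
  qed simp
  also have "(\<Sum>i\<in>UNIV. c i *\<^sub>R y i) = (1 - sum \<xi> UNIV) *\<^sub>R v + (\<Sum>k\<in>UNIV. \<xi> k *\<^sub>R V k)"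
    unfolding UNIV_eq by (simp add: sum.reindex c_def y_def)
  also have "\<dots> = v + (\<Sum>k\<in>UNIV. \<xi> k *\<^sub>R (V k - v))"
    by (simp add: scaleR_diff_right sum_subtractf scaleR_sum_left algebra_simps)
  finally show ?thesis .
qed

text \<open>The points of the simplex with vertices \<open>v\<close> and \<open>V k\<close> at which the barycentric coordinate
  of \<open>v\<close>, which is \<open>1 - sum \<xi> UNIV\<close>, is minimal. The two conditions make all
  coordinates nonnegative.\<close>
definition vertex_region :: "'a::real_vector \<Rightarrow> ('k::finite \<Rightarrow> 'a) \<Rightarrow> 'a set"
  where "vertex_region v V =
    {v + (\<Sum>k\<in>UNIV. \<xi> k *\<^sub>R (V k - v)) | \<xi>. sum \<xi> UNIV \<le> 1 \<and> (\<forall>k. 1 - sum \<xi> UNIV \<le> \<xi> k)}"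

text \<open>Use the coordinates \<open>\<xi>\<close> relative to \<open>v\<close> in which the simplex is
  \<open>\<xi> \<ge> 0, tot \<xi> \<le> 1\<close>. The rows move as \<open>(1 - s) *\<^sub>R V k + s *\<^sub>R w\<close>, where
  \<open>w\<close> is an interior point near \<open>v\<close> and \<open>s\<close> is a multiple of \<open>(t - c)\<^sup>2\<close>. At the time \<open>c\<close>
  they form the facet opposite to \<open>v\<close>. An error of at most a small
  multiple of \<open>(t - c)\<^sup>2\<close> amounts to replacing \<open>w\<close> by a nearby point \<open>X t k\<close> that depends on time
  and row. This keeps the rows in the simplex.

  For the covering, let \<open>\<Phi>\<close> send \<open>\<xi>\<close> to the combination of the rows with weights
  \<open>\<xi> $ k / tot \<xi>\<close> at the time when \<open>s = 1 - tot \<xi>\<close>. If \<open>w\<close> were \<open>v\<close> itself and the motion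
  unperturbed, \<open>\<Phi>\<close> would be the identity. In general it moves \<open>\<xi>\<close> by at most \<open>s / 3\<close> in each
  barycentric coordinate. Around a point whose smallest barycentric coordinate \<open>e\<close> belongs to
  \<open>v\<close>, all points of the box of radius \<open>e / 2\<close> satisfy \<open>s \<le> 3 * e / 2\<close>. So they are displaced
  by at most \<open>e / 2\<close>, and Brouwer's theorem shows that \<open>\<Phi>\<close> attains the centre of
  the box.\<close>
lemma robustly_swept_vertex_region:
  fixes v :: "real ^ 'n" and V :: "'n \<Rightarrow> real ^ 'n"
  assumes "convex P" "P \<subseteq> S" "v \<in> P" "\<And>k. V k \<in> P"
    and inj: "inj (\<lambda>\<xi>. \<Sum>k\<in>UNIV. \<xi> $ k *\<^sub>R (V k - v))"
  shows "\<exists>A :: (real ^ 'n) ^ 'n. (\<forall>k. A $ k \<in> interior P) \<and> robustly_swept S A A (vertex_region v V)"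
proof -
  define L where "L \<xi> = (\<Sum>k\<in>UNIV. \<xi> $ k *\<^sub>R (V k - v))" for \<xi> :: "real ^ 'n"
  have "linear L"
    unfolding L_def by (intro linearI) (simp_all add: scaleR_add_left sum.distrib scaleR_sum_right)
  have "inj L"
    unfolding L_def by (rule inj)
  then obtain g where g: "linear g" "\<And>x. g (L x) = x" "\<And>x. L (g x) = x"
    using linear_injective_isomorphism[OF \<open>linear L\<close>] by blast
  have g_cont: "continuous_on A g" for A
    using g(1) by (rule linear_continuous_on[OF linear_conv_bounded_linear[THEN iffD1]])
  define tot where "tot \<xi> = (\<Sum>k\<in>UNIV. \<xi> $ k)" for \<xi> :: "real ^ 'n"
  have tot_cont: "continuous_on A tot" for A
    unfolding tot_def by (intro continuous_intros)
  \<comment> \<open>An open part of the simplex, within \<open>1 / 3\<close> of \<open>v\<close> in barycentric coordinates. The auxiliary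
    points \<open>X t k\<close> will stay in it.\<close>
  define O' where "O' = (\<Inter>k. {x. 0 < g (x - v) $ k}) \<inter> {x. tot (g (x - v)) < 1 / 3}"
  have O': "x \<in> O' \<longleftrightarrow> (\<forall>k. 0 < g (x - v) $ k) \<and> tot (g (x - v)) < 1 / 3" for x
    by (auto simp: O'_def)
  have gv_cont: "continuous_on UNIV (\<lambda>x. g (x - v))"
    by (rule continuous_on_compose2[OF g_cont]) (auto intro!: continuous_intros)
  have "open O'"
    unfolding O'_def
    by (intro open_Int open_INT ballI open_Collect_less continuous_on_const
        continuous_on_component gv_cont continuous_on_compose2[OF tot_cont gv_cont]) auto
  have "O' \<subseteq> P"
  proof
    fix x assume "x \<in> O'"
    then have "v + L (g (x - v)) \<in> P"
      unfolding L_def by (intro vertex_coordinates_in_convex assms) (auto simp: O' tot_def less_imp_le)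
    then show "x \<in> P"
      by (simp add: g)
  qed
  then have "O' \<subseteq> interior P"
    using \<open>open O'\<close> by (rule interior_maximal)
  define w where "w = v + L (\<chi> k. 1 / (6 * real CARD('n)))"
  have "w \<in> O'"
    by (simp add: w_def O' g tot_def)
  then obtain r where r: "r > 0" "ball w r \<subseteq> O'"
    using \<open>open O'\<close> by (auto simp: open_contains_ball)
  \<comment> \<open>A minimal barycentric coordinate is at most \<open>1 / 2\<close>, and \<open>s\<close> has to reach \<open>3 / 2\<close> times its
    value. So it suffices that \<open>s\<close> runs up to \<open>3 / 4\<close>.\<close>
  define \<beta> where "\<beta> c t = (\<chi> k. V k) + (3 / 4 * (t - c)\<^sup>2) *\<^sub>R (\<chi> k. w - V k)" for c t :: real
  have \<beta>_poly: "polynomial_function (\<beta> c)" for c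
  proof -
    have "real_polynomial_function (\<lambda>t::real. 3 / 4 * (t - c)\<^sup>2)"
      by (intro real_polynomial_function_power real_polynomial_function_diff real_polynomial_function.intros(2-))
        (simp_all add: real_polynomial_function_eq)
    then show ?thesis
      unfolding \<beta>_def by (intro polynomial_function_add polynomial_function_mult)
        (simp_all add: real_polynomial_function_eq)
  qed
  define A where "A = (\<chi> k. V k - (3 / 4) *\<^sub>R (V k - w))"
  have "A $ k \<in> interior P" for k
    using mem_interior_convex_shrink[OF assms(1) _ assms(4)[of k], of w "3 / 4"]
      \<open>w \<in> O'\<close> \<open>O' \<subseteq> interior P\<close> by (auto simp: A_def)
  moreover have "robustly_swept S A A (vertex_region v V)"
    unfolding robustly_swept_def
  proof
    fix a :: real
    define c b where "c = a + 1" and "b = a + 2"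
    have ends: "\<beta> c a = A" "\<beta> c b = A"
      by (simp_all add: \<beta>_def A_def c_def b_def vec_eq_iff algebra_simps)
    have "robust_path S (vertex_region v V) (\<beta> c) a b"
    proof (rule robust_pathI_polynomial[OF \<beta>_poly, where Z = "{c}" and \<kappa> = "r / 4" and m = 2])
      fix \<gamma> assume \<gamma>_cont: "continuous_on {a..b} \<gamma>"
        and \<gamma>_close: "\<And>t. t \<in> {a..b} \<Longrightarrow> dist (\<gamma> t) (\<beta> c t) \<le> r / 4 * zero_weight {c} 2 t"
      define s where "s t = 3 / 4 * (t - c)\<^sup>2" for t
      have s_range: "0 \<le> s t" "s t \<le> 3 / 4" if "t \<in> {a..b}" for t
      proof -
        have "\<bar>t - c\<bar> \<le> 1"
          using that by (auto simp: c_def b_def)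
        then show "0 \<le> s t" "s t \<le> 3 / 4"
          by (simp_all add: s_def abs_square_le_1)
      qed
      have "\<exists>X\<in>ball w r. \<gamma> t $ k = (1 - s t) *\<^sub>R V k + s t *\<^sub>R X" if t: "t \<in> {a..b}" for t k
      proof -
        have "dist (\<gamma> t $ k) (\<beta> c t $ k) \<le> r / 4 * (min 1 \<bar>t - c\<bar>)\<^sup>2"
          using dist_vec_nth[of "\<gamma> t" k "\<beta> c t"] \<gamma>_close[OF t] by (simp add: zero_weight_def)
        also have "(min 1 \<bar>t - c\<bar>)\<^sup>2 \<le> \<bar>t - c\<bar>\<^sup>2"
          by (intro power_mono) auto
        finally have d: "norm (\<gamma> t $ k - \<beta> c t $ k) \<le> r / 3 * s t"
          using r(1) by (simp add: s_def dist_norm)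
        have \<beta>_k: "\<beta> c t $ k = (1 - s t) *\<^sub>R V k + s t *\<^sub>R w"
          by (simp add: \<beta>_def s_def algebra_simps)
        show ?thesis
        proof (cases "s t = 0")
          case True
          then show ?thesis
            using d \<beta>_k r(1) by (intro bexI[of _ w]) auto
        next
          case False
          then have "s t > 0"
            using s_range[OF t] by simp
          define X where "X = w + (1 / s t) *\<^sub>R (\<gamma> t $ k - \<beta> c t $ k)"
          have "norm ((1 / s t) *\<^sub>R (\<gamma> t $ k - \<beta> c t $ k)) \<le> r / 3"
            unfolding norm_scaleR using d \<open>s t > 0\<close> by (simp add: field_simps)
          then have "norm ((1 / s t) *\<^sub>R (\<gamma> t $ k - \<beta> c t $ k)) < r"
            using r(1) by linarith
          then have "X \<in> ball w r"
            by (simp add: X_def dist_norm)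
          moreover have "\<gamma> t $ k = (1 - s t) *\<^sub>R V k + s t *\<^sub>R X"
            using \<open>s t > 0\<close> \<beta>_k by (simp add: X_def scaleR_add_right)
          ultimately show ?thesis
            by blast
        qed
      qed
      then have "\<forall>t\<in>{a..b}. \<forall>k. \<exists>x. x \<in> ball w r \<and> \<gamma> t $ k = (1 - s t) *\<^sub>R V k + s t *\<^sub>R x"
        by blast
      then have "\<forall>t\<in>{a..b}. \<exists>x. \<forall>k. x k \<in> ball w r \<and> \<gamma> t $ k = (1 - s t) *\<^sub>R V k + s t *\<^sub>R x k"
        by (simp only: choice_iff)
      then obtain X where X: "\<And>t k. t \<in> {a..b} \<Longrightarrow> X t k \<in> ball w r"
        "\<And>t k. t \<in> {a..b} \<Longrightarrow> \<gamma> t $ k = (1 - s t) *\<^sub>R V k + s t *\<^sub>R X t k"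
        by (auto simp only: bchoice_iff)
      have "sweep \<gamma> a b \<subseteq> S"
      proof (rule sweep_subset_convex)
        fix t assume t: "t \<in> {a..b}"
        have "\<gamma> t $ k \<in> P" for k
          unfolding X(2)[OF t]
          using s_range[OF t] X(1)[OF t, of k] r(2) \<open>O' \<subseteq> P\<close> assms(4)[of k]
          by (intro convexD_alt[OF assms(1)]) auto
        then show "\<exists>P. convex P \<and> P \<subseteq> S \<and> (\<forall>k. \<gamma> t $ k \<in> P)"
          using assms(1,2) by blast
      qed
      moreover have "vertex_region v V \<subseteq> sweep \<gamma> a b"
      proof
        fix q assume "q \<in> vertex_region v V"
        then obtain \<eta>' where \<eta>': "q = v + (\<Sum>k\<in>UNIV. \<eta>' k *\<^sub>R (V k - v))"
          "sum \<eta>' UNIV \<le> 1" "\<And>k. 1 - sum \<eta>' UNIV \<le> \<eta>' k"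
          unfolding vertex_region_def by blast
        define \<eta> where "\<eta> = (\<chi> k. \<eta>' k)"
        define e where "e = 1 - tot \<eta>"
        have q: "q = v + L \<eta>" and e: "0 \<le> e" "\<And>k. e \<le> \<eta> $ k"
          using \<eta>' by (auto simp: L_def \<eta>_def e_def tot_def)
        \<comment> \<open>If \<open>e = 0\<close> then \<open>q\<close> lies on the facet, which is met exactly at the time \<open>c\<close>.\<close>
        show "q \<in> sweep \<gamma> a b"
        proof (cases "e = 0")
          case True
          have c_mem: "c \<in> {a..b}"
            by (simp add: c_def b_def)
          have "s c = 0"
            by (simp add: s_def)
          then have "\<gamma> c $ k = V k" for k
            using X(2)[OF c_mem, of k] by simp
          moreover have "q = (\<Sum>k\<in>UNIV. \<eta> $ k *\<^sub>R V k) + (1 - tot \<eta>) *\<^sub>R v"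
            by (simp add: q L_def tot_def scaleR_diff_right sum_subtractf scaleR_sum_left algebra_simps)
          ultimately show ?thesis
            using True e by (intro sweepI[OF c_mem, of "\<lambda>k. \<eta> $ k"]) (auto simp: e_def tot_def)
        next
          case False
          then have "e > 0"
            using e(1) by simp
          have "e \<le> \<eta> $ undefined"
            by (rule e(2))
          also have "\<dots> \<le> tot \<eta>"
            unfolding tot_def using e by (intro member_le_sum) (auto intro: order_trans)
          finally have "e \<le> 1 / 2"
            by (simp add: e_def)
          \<comment> \<open>The box of radius \<open>e / 2\<close> with respect to all \<open>n + 1\<close> barycentric coordinates.\<close>
          define T where "T = cbox (\<eta> - (\<chi> k. e / 2)) (\<eta> + (\<chi> k. e / 2)) \<inter>
            ({\<xi>. (\<chi> k. 1) \<bullet> \<xi> \<le> tot \<eta> + e / 2} \<inter> {\<xi>. (\<chi> k. 1) \<bullet> \<xi> \<ge> tot \<eta> - e / 2})"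
          have tot_inner: "(\<chi> k. 1) \<bullet> \<xi> = tot \<xi>" for \<xi> :: "real ^ 'n"
            by (simp add: inner_vec_def tot_def)
          have T: "\<xi> \<in> T \<longleftrightarrow> (\<forall>k. \<bar>\<xi> $ k - \<eta> $ k\<bar> \<le> e / 2) \<and> \<bar>tot \<xi> - tot \<eta>\<bar> \<le> e / 2" for \<xi>
            unfolding T_def abs_diff_le_iff by (auto simp: mem_box_cart tot_inner)
          have T_facts: "\<xi> $ k > 0" "1 / 4 \<le> tot \<xi>" "e / 2 \<le> 1 - tot \<xi>" "1 - tot \<xi> \<le> 3 * e / 2" if "\<xi> \<in> T" for \<xi> k
          proof -
            have "\<bar>\<xi> $ k - \<eta> $ k\<bar> \<le> e / 2" "\<bar>tot \<xi> - tot \<eta>\<bar> \<le> e / 2"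
              using that T by auto
            then show "\<xi> $ k > 0" "1 / 4 \<le> tot \<xi>" "e / 2 \<le> 1 - tot \<xi>" "1 - tot \<xi> \<le> 3 * e / 2"
              using e(2)[of k] \<open>e > 0\<close> \<open>e \<le> 1 / 2\<close> e_def unfolding abs_diff_le_iff by linarith+
          qed
          have "compact T"
            unfolding T_def by (intro compact_Int_closed compact_cbox closed_Int closed_halfspace_le closed_halfspace_ge)
          have "convex T"
            unfolding T_def by (intro convex_Int convex_box convex_halfspace_le convex_halfspace_ge)
          have "\<eta> \<in> T"
            using \<open>e > 0\<close> by (simp add: T)
          \<comment> \<open>The time after \<open>c\<close> at which \<open>s\<close> equals \<open>1 - tot \<xi>\<close>.\<close>
          define \<tau> where "\<tau> \<xi> = c + sqrt (4 / 3 * (1 - tot \<xi>))" for \<xi>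
          have \<tau>: "\<tau> \<xi> \<in> {a..b}" "s (\<tau> \<xi>) = 1 - tot \<xi>" if "\<xi> \<in> T" for \<xi>
            using T_facts[OF that] \<open>e > 0\<close> by (auto simp: \<tau>_def c_def b_def s_def)
          define \<Phi> where "\<Phi> \<xi> = g ((\<Sum>k\<in>UNIV. (\<xi> $ k / tot \<xi>) *\<^sub>R \<gamma> (\<tau> \<xi>) $ k) - v)" for \<xi>
          have \<Phi>_cont: "continuous_on T \<Phi>"
          proof -
            have "continuous_on T \<tau>"
              unfolding \<tau>_def by (intro continuous_intros tot_cont)
            then have "continuous_on T (\<lambda>\<xi>. \<gamma> (\<tau> \<xi>))"
              using \<tau>(1) by (intro continuous_on_compose2[OF \<gamma>_cont]) auto
            moreover have "tot \<xi> \<noteq> 0" if "\<xi> \<in> T" for \<xi>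
              using T_facts(2)[OF that] by auto
            ultimately show ?thesis
              unfolding \<Phi>_def
              by (intro continuous_on_compose2[OF g_cont[of UNIV]] continuous_intros tot_cont) auto
          qed
          have maps: "\<eta> + (\<xi> - \<Phi> \<xi>) \<in> T" if \<xi>: "\<xi> \<in> T" for \<xi>
          proof -
            define \<sigma> where "\<sigma> = 1 - tot \<xi>"
            have \<sigma>: "0 < \<sigma>" "\<sigma> \<le> 3 * e / 2" "tot \<xi> = 1 - \<sigma>" "1 - \<sigma> > 0"
              using T_facts[OF \<xi>] \<open>e > 0\<close> by (auto simp: \<sigma>_def)
            define Y where "Y = (\<Sum>k\<in>UNIV. (\<xi> $ k / tot \<xi>) *\<^sub>R X (\<tau> \<xi>) k)"
            have "Y \<in> ball w r"
              unfolding Y_def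
            proof (rule convex_sum)
              show "(\<Sum>k\<in>UNIV. \<xi> $ k / tot \<xi>) = 1"
                using \<sigma> by (simp add: sum_divide_distrib[symmetric] tot_def[symmetric])
              show "\<xi> $ k / tot \<xi> \<ge> 0" for k
                using T_facts(1)[OF \<xi>, of k] \<sigma> by simp
            qed (use X(1)[OF \<tau>(1)[OF \<xi>]] in auto)
            then have Y: "\<And>k. 0 < g (Y - v) $ k" "tot (g (Y - v)) < 1 / 3"
              using r(2) by (auto simp: O')
            then have Y': "g (Y - v) $ k < 1 / 3" for k
              using member_le_sum[of k UNIV "\<lambda>k. g (Y - v) $ k"] by (force simp: tot_def intro: less_imp_le le_less_trans)
            have "(\<Sum>k\<in>UNIV. (\<xi> $ k / tot \<xi>) *\<^sub>R \<gamma> (\<tau> \<xi>) $ k)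
                = (\<Sum>k\<in>UNIV. \<xi> $ k *\<^sub>R V k + \<sigma> *\<^sub>R ((\<xi> $ k / tot \<xi>) *\<^sub>R X (\<tau> \<xi>) k))"
            proof (rule sum.cong)
              fix k
              have "\<gamma> (\<tau> \<xi>) $ k = tot \<xi> *\<^sub>R V k + \<sigma> *\<^sub>R X (\<tau> \<xi>) k"
                using X(2)[OF \<tau>(1)[OF \<xi>], of k] \<tau>(2)[OF \<xi>] by (simp add: \<sigma>_def)
              then show "(\<xi> $ k / tot \<xi>) *\<^sub>R \<gamma> (\<tau> \<xi>) $ k
                  = \<xi> $ k *\<^sub>R V k + \<sigma> *\<^sub>R ((\<xi> $ k / tot \<xi>) *\<^sub>R X (\<tau> \<xi>) k)"
                using \<sigma>(3,4) by (simp add: scaleR_add_right)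
            qed simp
            also have "\<dots> = (\<Sum>k\<in>UNIV. \<xi> $ k *\<^sub>R V k) + \<sigma> *\<^sub>R Y"
              by (simp add: Y_def sum.distrib scaleR_sum_right)
            also have "(\<Sum>k\<in>UNIV. \<xi> $ k *\<^sub>R V k) = L \<xi> + tot \<xi> *\<^sub>R v"
              by (simp add: L_def tot_def scaleR_diff_right sum_subtractf scaleR_sum_left)
            finally have sum_\<gamma>: "(\<Sum>k\<in>UNIV. (\<xi> $ k / tot \<xi>) *\<^sub>R \<gamma> (\<tau> \<xi>) $ k) =
                L \<xi> + tot \<xi> *\<^sub>R v + \<sigma> *\<^sub>R Y" .
            have "\<Phi> \<xi> = g (L \<xi> + \<sigma> *\<^sub>R (Y - v))"
              unfolding \<Phi>_def sum_\<gamma> unfolding \<sigma>(3) by (simp add: algebra_simps)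
            also have "\<dots> = \<xi> + \<sigma> *\<^sub>R g (Y - v)"
              by (simp add: linear_add[OF g(1)] linear_cmul[OF g(1)] g(2))
            finally have \<Phi>: "\<xi> - \<Phi> \<xi> = - \<sigma> *\<^sub>R g (Y - v)"
              by simp
            have small: "0 \<le> \<sigma> * x" "\<sigma> * x \<le> e / 2" if "0 \<le> x" "x < 1 / 3" for x
              using mult_mono[of \<sigma> "3 * e / 2" x "1 / 3"] that \<sigma>(1,2) \<open>e > 0\<close> by simp_all
            have "0 \<le> tot (g (Y - v))"
              unfolding tot_def using Y(1) by (intro sum_nonneg less_imp_le)
            then have "\<bar>\<sigma> * tot (g (Y - v))\<bar> \<le> e / 2"
              using small Y(2) by simp
            moreover have "\<bar>\<sigma> * g (Y - v) $ k\<bar> \<le> e / 2" for k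
              using small[of "g (Y - v) $ k"] Y(1)[of k] Y'[of k] by simp
            moreover have "tot (\<eta> + (\<xi> - \<Phi> \<xi>)) = tot \<eta> - \<sigma> * tot (g (Y - v))"
              unfolding \<Phi> by (simp add: tot_def sum_subtractf sum_distrib_left)
            ultimately show ?thesis
              unfolding T by (simp add: \<Phi>)
          qed
          have "\<exists>\<xi>\<in>T. \<Phi> \<xi> = \<eta>"
            by (rule brouwer_surjective[where S = "{\<eta>}", OF \<open>compact T\<close> \<open>convex T\<close> _ \<Phi>_cont])
              (use maps \<open>\<eta> \<in> T\<close> in auto)
          then obtain \<xi> where \<xi>: "\<xi> \<in> T" "\<Phi> \<xi> = \<eta>"
            by blast
          then have "L \<eta> = (\<Sum>k\<in>UNIV. (\<xi> $ k / tot \<xi>) *\<^sub>R \<gamma> (\<tau> \<xi>) $ k) - v"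
            using g(3) by (metis \<Phi>_def)
          then have "q = (\<Sum>k\<in>UNIV. (\<xi> $ k / tot \<xi>) *\<^sub>R \<gamma> (\<tau> \<xi>) $ k)"
            by (simp add: q)
          moreover have "0 \<le> \<xi> $ k / tot \<xi>" for k
            using T_facts(1)[OF \<xi>(1), of k] T_facts(2)[OF \<xi>(1)] by simp
          moreover have "(\<Sum>k\<in>UNIV. \<xi> $ k / tot \<xi>) = 1"
            using T_facts(2)[OF \<xi>(1)] by (simp add: sum_divide_distrib[symmetric] tot_def[symmetric])
          ultimately show ?thesis
            by (intro sweepI[OF \<tau>(1)[OF \<xi>(1)], of "\<lambda>k. \<xi> $ k / tot \<xi>"]) auto
        qed
      qed
      ultimately show "vertex_region v V \<subseteq> sweep \<gamma> a b \<and> sweep \<gamma> a b \<subseteq> S"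
        by blast
    qed (use r in \<open>auto simp: c_def b_def\<close>)
    then show "\<exists>b \<beta>. a < b \<and> \<beta> a = A \<and> \<beta> b = A \<and> robust_path S (vertex_region v V) \<beta> a b"
      using ends by (intro exI[of _ b] exI[of _ "\<beta> c"]) (simp add: b_def)
  qed
  ultimately show ?thesis
    by blast
qed

text \<open>A vertex set of minimal cardinality whose hull contains \<open>x\<close> is affinely independent by
  Caratheodory's theorem. It extends to an affine basis within \<open>E\<close>. The vertex at which
  the barycentric coordinate of \<open>x\<close> is smallest plays the role of \<open>v\<close>.\<close>
lemma polytope_covered_by_vertex_regions:
  fixes E :: "(real ^ 'n) set"
  assumes E: "finite E" "aff_dim E = int CARD('n)" and x: "x \<in> convex hull E"
  shows "\<exists>v\<in>E. \<exists>V :: 'n \<Rightarrow> real ^ 'n. range V \<subseteq> E \<and>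
    inj (\<lambda>\<xi>. \<Sum>k\<in>UNIV. \<xi> $ k *\<^sub>R (V k - v)) \<and> x \<in> vertex_region v V"
proof -
  have "\<exists>C. C \<subseteq> E \<and> x \<in> convex hull C"
    using x by blast
  then obtain C where C: "C \<subseteq> E" "x \<in> convex hull C"
    and min: "\<And>D. D \<subseteq> E \<Longrightarrow> x \<in> convex hull D \<Longrightarrow> card C \<le> card D"
    using exists_least_lemma ex_has_least_nat[of "\<lambda>C. C \<subseteq> E \<and> x \<in> convex hull C" _ card] by metis
  have "finite C"
    using C(1) E(1) by (rule finite_subset)
  obtain D where D: "D \<subseteq> C" "int (card D) \<le> aff_dim C + 1" "x \<in> convex hull D"
    using C(2) unfolding caratheodory_aff_dim[of C] by blast
  then have "card C \<le> card D"
    using C(1) by (intro min) auto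
  then have "aff_dim C = int (card C) - 1"
    using D(2) aff_dim_le_card[OF \<open>finite C\<close>] by linarith
  then have "\<not> affine_dependent C"
    using \<open>finite C\<close> affine_independent_iff_card by blast
  then obtain T where T: "\<not> affine_dependent T" "C \<subseteq> T" "T \<subseteq> E" "affine hull T = affine hull E"
    using C(1) by (rule extend_to_affine_basis)
  have "finite T"
    using T(3) E(1) by (rule finite_subset)
  have "aff_dim T = aff_dim E"
    using T(4) by (metis aff_dim_affine_hull)
  then have card_T: "card T = CARD('n) + 1"
    using aff_dim_affine_independent[OF T(1)] E(2) by simp
  then have "T \<noteq> {}"
    by auto
  have "x \<in> convex hull T"
    using C(2) hull_mono[OF T(2)] by blast
  then obtain \<mu> where \<mu>: "\<And>u. u \<in> T \<Longrightarrow> 0 \<le> \<mu> u" "sum \<mu> T = 1" "(\<Sum>u\<in>T. \<mu> u *\<^sub>R u) = x"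
    unfolding convex_hull_finite[OF \<open>finite T\<close>] by blast
  obtain v where v: "v \<in> T" "\<And>u. u \<in> T \<Longrightarrow> \<mu> v \<le> \<mu> u"
    using ex_is_arg_min_if_finite[OF \<open>finite T\<close> \<open>T \<noteq> {}\<close>, of \<mu>] by (auto simp: is_arg_min_linorder)
  have "card (T - {v}) = CARD('n)"
    using card_T v(1) \<open>finite T\<close> by simp
  then obtain V :: "'n \<Rightarrow> real ^ 'n" where V: "bij_betw V UNIV (T - {v})"
    using finite_same_card_bij[of "UNIV :: 'n set" "T - {v}"] \<open>finite T\<close> by auto
  have sum_T: "(\<Sum>u\<in>T. f u) = f v + (\<Sum>k\<in>UNIV. f (V k))" for f :: "real ^ 'n \<Rightarrow> 'b::comm_monoid_add"
    using sum.remove[OF \<open>finite T\<close> v(1), of f] sum.reindex_bij_betw[OF V, of f] by simp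
  have V_mem: "V k \<in> T" "V k \<noteq> v" for k
    using V by (auto simp: bij_betw_def)
  have "x \<in> vertex_region v V"
    unfolding vertex_region_def
  proof (intro CollectI exI[of _ "\<mu> \<circ> V"] conjI allI)
    have \<mu>v: "\<mu> v = 1 - sum (\<mu> \<circ> V) UNIV"
      using \<mu>(2) unfolding sum_T by simp
    show "x = v + (\<Sum>k\<in>UNIV. (\<mu> \<circ> V) k *\<^sub>R (V k - v))"
      using \<mu>(3) unfolding sum_T \<mu>v
      by (simp add: scaleR_diff_right sum_subtractf scaleR_sum_left algebra_simps)
    show "sum (\<mu> \<circ> V) UNIV \<le> 1"
      using \<mu>v \<mu>(1)[OF v(1)] by simp
    show "1 - sum (\<mu> \<circ> V) UNIV \<le> (\<mu> \<circ> V) k" for k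
      using \<mu>v v(2)[OF V_mem(1)] by simp
  qed
  moreover have "inj (\<lambda>\<xi>. \<Sum>k\<in>UNIV. \<xi> $ k *\<^sub>R (V k - v))"
  proof -
    have "linear (\<lambda>\<xi>. \<Sum>k\<in>UNIV. \<xi> $ k *\<^sub>R (V k - v))"
      by (intro linearI) (simp_all add: scaleR_add_left sum.distrib scaleR_sum_right)
    moreover have "\<xi> = 0" if "(\<Sum>k\<in>UNIV. \<xi> $ k *\<^sub>R (V k - v)) = 0" for \<xi> :: "real ^ 'n"
    proof -
      \<comment> \<open>A linear relation between the edges at \<open>v\<close> is an affine relation between the vertices.\<close>
      define U where "U u = (if u = v then - (\<Sum>k\<in>UNIV. \<xi> $ k) else \<xi> $ inv V u)" for u
      have inj_V: "inj V"
        using V by (simp add: bij_betw_def)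
      have U: "U v = - (\<Sum>k\<in>UNIV. \<xi> $ k)" "U (V k) = \<xi> $ k" for k
        using V_mem(2)[of k] inj_V by (simp_all add: U_def)
      have "sum U T = 0"
        unfolding sum_T U by simp
      moreover have "(\<Sum>u\<in>T. U u *\<^sub>R u) = 0"
        unfolding sum_T U using that
        by (simp add: scaleR_diff_right sum_subtractf scaleR_sum_left)
      ultimately have "\<forall>u\<in>T. U u = 0"
        using T(1) unfolding affine_dependent_explicit_finite[OF \<open>finite T\<close>] by blast
      then have "\<xi> $ k = 0" for k
        using V_mem(1)[of k] U(2)[of k] by metis
      then show ?thesis
        by (simp add: vec_eq_iff)
    qed
    ultimately show ?thesis
      by (simp add: linear_injective_0)
  qed
  moreover have "range V \<subseteq> E" "v \<in> E"
    using V_mem T(3) v(1) by auto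
  ultimately show ?thesis
    by blast
qed

lemma robustly_swept_UN:
  assumes "finite I" "robustly_swept S A A {}" "\<And>i. i \<in> I \<Longrightarrow> robustly_swept S A A (C i)"
  shows "robustly_swept S A A (\<Union>i\<in>I. C i)"
  using assms(1,3)
proof (induction I)
  case empty
  then show ?case
    using assms(2) by simp
next
  case (insert i I)
  then show ?case
    using robustly_swept_trans[of S A A "C i" A "\<Union>i\<in>I. C i"] by simp
qed

text \<open>The motion returns to the interior point \<open>p\<close> between any two regions, so that the regions can be
  covered one after the other. The set \<open>C\<close> is the union of the regions.\<close>
lemma robustly_swept_polytope:
  fixes P :: "(real ^ 'n) set"
  assumes "polyhedron P" "compact P" "aff_dim P = int CARD('n)" "P \<subseteq> S" "p \<in> interior P"
  shows "\<exists>C. P \<subseteq> C \<and> robustly_swept S (\<chi> k::'n. p) (\<chi> k. p) C"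
proof -
  obtain E where E: "finite E" "P = convex hull E"
    using assms(1,2) polytope_eq_bounded_polyhedron[of P] compact_imp_bounded
    unfolding polytope_def by blast
  have "convex P"
    by (simp add: E)
  define I where "I = {(v, V). v \<in> E \<and> V \<in> (UNIV :: 'n set) \<rightarrow>\<^sub>E E \<and>
    inj (\<lambda>\<xi> :: real ^ 'n. \<Sum>k\<in>UNIV. \<xi> $ k *\<^sub>R (V k - v))}"
  have "I \<subseteq> E \<times> ((UNIV :: 'n set) \<rightarrow>\<^sub>E E)"
    by (auto simp: I_def)
  moreover have "finite (E \<times> ((UNIV :: 'n set) \<rightarrow>\<^sub>E E))"
    using E(1) by (intro finite_cartesian_product finite_PiE) auto
  ultimately have "finite I"
    by (rule finite_subset)
  have loop: "robustly_swept S (\<chi> k::'n. p) (\<chi> k. p) (vertex_region v V)" if vV: "(v, V) \<in> I" for v V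
  proof -
    have mem: "v \<in> P" "V k \<in> P" for k
      using vV hull_inc[of _ E] unfolding I_def E(2) by auto
    have "inj (\<lambda>\<xi> :: real ^ 'n. \<Sum>k\<in>UNIV. \<xi> $ k *\<^sub>R (V k - v))"
      using vV by (simp add: I_def)
    from robustly_swept_vertex_region[OF \<open>convex P\<close> assms(4) mem this]
    obtain A :: "(real ^ 'n) ^ 'n" where A: "\<And>k. A $ k \<in> interior P"
      and swept: "robustly_swept S A A (vertex_region v V)"
      by blast
    have there: "robustly_swept S (\<chi> k. p) A {}"
      by (rule robustly_swept_segment[OF \<open>convex P\<close> assms(4)]) (use A assms(5) in simp_all)
    have away: "robustly_swept S A (\<chi> k. p) {}"
      by (rule robustly_swept_segment[OF \<open>convex P\<close> assms(4)]) (use A assms(5) in simp_all)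
    show ?thesis
      using robustly_swept_trans[OF robustly_swept_trans[OF there swept] away] by simp
  qed
  have "robustly_swept S (\<chi> k::'n. p) (\<chi> k. p) {}"
    by (rule robustly_swept_segment[OF \<open>convex P\<close> assms(4)]) (use assms(5) in simp_all)
  then have "robustly_swept S (\<chi> k::'n. p) (\<chi> k. p) (\<Union>(v, V)\<in>I. vertex_region v V)"
    using \<open>finite I\<close> loop by (intro robustly_swept_UN) auto
  moreover have "P \<subseteq> (\<Union>(v, V)\<in>I. vertex_region v V)"
  proof
    fix x assume "x \<in> P"
    moreover have "aff_dim E = int CARD('n)"
      using assms(3) by (simp add: E(2) aff_dim_convex_hull)
    ultimately obtain v and V :: "'n \<Rightarrow> real ^ 'n" where "v \<in> E" "range V \<subseteq> E"
      "inj (\<lambda>\<xi> :: real ^ 'n. \<Sum>k\<in>UNIV. \<xi> $ k *\<^sub>R (V k - v))" "x \<in> vertex_region v V"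
      using polytope_covered_by_vertex_regions[OF E(1), of x] E(2) by blast
    then show "x \<in> (\<Union>(v, V)\<in>I. vertex_region v V)"
      by (auto simp: I_def intro!: bexI[of _ "(v, V)"])
  qed
  ultimately show ?thesis
    by blast
qed

section \<open>Polynomial images of the ball\<close>

text \<open>Hyperplanes are null sets, whereas a nonempty open set is not.\<close>
lemma exists_interior_point_off_hyperplanes:
  fixes P :: "'a::euclidean_space set"
  assumes "interior P \<noteq> {}" "finite H" "\<And>c d. (c, d) \<in> H \<Longrightarrow> c \<noteq> 0"
  shows "\<exists>p\<in>interior P. \<forall>(c, d)\<in>H. c \<bullet> p \<noteq> d"
proof -
  have "negligible (\<Union>(c, d)\<in>H. {x. c \<bullet> x = d})"
    using assms(2,3) by (intro negligible_Union finite_imageI) (auto intro!: negligible_hyperplane)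
  then have "\<not> interior P \<subseteq> (\<Union>(c, d)\<in>H. {x. c \<bullet> x = d})"
    using open_not_negligible[OF open_interior assms(1)] negligible_subset by blast
  then show ?thesis
    by blast
qed

lemma polyhedron_as_halfspaces:
  fixes P :: "'a::euclidean_space set"
  assumes "polyhedron P"
  shows "\<exists>G. finite G \<and> (\<forall>(c, d)\<in>G. c \<noteq> 0) \<and> P = {x. \<forall>(c, d)\<in>G. c \<bullet> x \<le> d}"
proof -
  obtain F where F: "finite F" "P = \<Inter>F" "\<forall>h\<in>F. \<exists>c d. c \<noteq> 0 \<and> h = {x. c \<bullet> x \<le> d}"
    using assms unfolding polyhedron_def by blast
  then have "\<forall>h\<in>F. \<exists>cd. fst cd \<noteq> 0 \<and> h = {x. fst cd \<bullet> x \<le> snd cd}"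
    by simp
  from bchoice[OF this] obtain cd where cd: "\<forall>h\<in>F. fst (cd h) \<noteq> 0 \<and> h = {x. fst (cd h) \<bullet> x \<le> snd (cd h)}"
    by blast
  have "x \<in> P \<longleftrightarrow> (\<forall>h\<in>F. fst (cd h) \<bullet> x \<le> snd (cd h))" for x
    unfolding F(2) using cd by blast
  then have "P = {x. \<forall>(c, d)\<in>cd ` F. c \<bullet> x \<le> d}"
    by (auto simp: case_prod_beta)
  then show ?thesis
    using F(1) cd by (intro exI[of _ "cd ` F"]) (auto simp: case_prod_beta)
qed

text \<open>The expansion of a polynomial at \<open>t\<close> is the finite sum of powers that represents
  the translated polynomial. The components may have different degrees, so the coefficients are
  padded with zeros.\<close>
lemma polynomial_function_real_analytic:
  fixes g :: "real \<Rightarrow> real ^ 'n"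
  assumes "polynomial_function g"
  shows "g real_analytic_on U"
  unfolding real_analytic_on_def
proof
  fix t
  have "\<exists>a N. \<forall>x. g (t + x) $ i = (\<Sum>k\<le>N. a k * x ^ k)" for i
  proof -
    have "polynomial_function (\<lambda>x::real. t + x)"
      by (intro polynomial_function_add) auto
    then have "polynomial_function (g \<circ> (\<lambda>x. t + x))"
      using assms by (rule polynomial_function_compose)
    then have "real_polynomial_function ((\<lambda>y. y $ i) \<circ> (g \<circ> (\<lambda>x. t + x)))"
      unfolding polynomial_function_def using bounded_linear_vec_nth by blast
    then obtain a N where "(\<lambda>x. g (t + x) $ i) = (\<lambda>x. \<Sum>k\<le>N. a k * x ^ k)"
      unfolding real_polynomial_function_iff_sum o_def by blast
    from fun_cong[OF this] show ?thesis
      by blast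
  qed
  then have "\<forall>i. \<exists>aN. \<forall>x. g (t + x) $ i = (\<Sum>k\<le>snd aN. fst aN k * x ^ k)"
    by simp
  from choice[OF this] obtain aN :: "'n \<Rightarrow> (nat \<Rightarrow> real) \<times> nat"
    where aN: "\<And>i x. g (t + x) $ i = (\<Sum>k\<le>snd (aN i). fst (aN i) k * x ^ k)"
    by blast
  define M where "M = Max (range (\<lambda>i. snd (aN i)))"
  define b where "b k = (\<chi> i. if k \<le> snd (aN i) then fst (aN i) k else 0)" for k
  have M: "snd (aN i) \<le> M" for i
    by (simp add: M_def)
  have "(\<lambda>k. (s - t) ^ k *\<^sub>R b k) sums g s" for s
  proof -
    have "(\<lambda>k. (s - t) ^ k *\<^sub>R b k) sums (\<Sum>k\<le>M. (s - t) ^ k *\<^sub>R b k)"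
    proof (rule sums_finite)
      show "(s - t) ^ k *\<^sub>R b k = 0" if "k \<notin> {..M}" for k
      proof -
        have "b k = 0"
          using that M by (auto simp: b_def vec_eq_iff not_le dest: le_less_trans)
        then show ?thesis
          by simp
      qed
    qed simp
    also have "(\<Sum>k\<le>M. (s - t) ^ k *\<^sub>R b k) = g s"
      unfolding vec_eq_iff
    proof
      fix i
      have "(\<Sum>k\<le>M. (s - t) ^ k *\<^sub>R b k) $ i = (\<Sum>k\<le>M. if k \<le> snd (aN i) then fst (aN i) k * (s - t) ^ k else 0)"
        by (auto simp: b_def intro!: sum.cong)
      also have "\<dots> = (\<Sum>k\<in>{k\<in>{..M}. k \<le> snd (aN i)}. fst (aN i) k * (s - t) ^ k)"
        by (rule sum.inter_filter[symmetric]) simp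
      also have "{k\<in>{..M}. k \<le> snd (aN i)} = {..snd (aN i)}"
        using M[of i] by auto
      also have "(\<Sum>k\<le>snd (aN i). fst (aN i) k * (s - t) ^ k) = g s $ i"
        using aN[of "s - t" i] by simp
      finally show "(\<Sum>k\<le>M. (s - t) ^ k *\<^sub>R b k) $ i = g s $ i" .
    qed
    finally show ?thesis .
  qed
  then show "\<exists>a. \<forall>\<^sub>F s in nhds t. (\<lambda>k. (s - t) ^ k *\<^sub>R a k) sums g s"
    by (intro exI[of _ b] always_eventually) blast
qed

lemma polynomial_image_connected_by_analytic_paths:
  fixes f :: "'a::euclidean_space \<Rightarrow> real ^ 'n"
  assumes "polynomial_function f" "convex B"
  shows "connected_by_analytic_paths (f ` B)"
  unfolding connected_by_analytic_paths_def
proof (intro ballI)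
  fix p q assume "p \<in> f ` B" "q \<in> f ` B"
  then obtain x y where xy: "x \<in> B" "y \<in> B" "p = f x" "q = f y"
    by blast
  define g where "g = f \<circ> (\<lambda>t::real. x + t *\<^sub>R (y - x))"
  have "polynomial_function (\<lambda>t::real. x + t *\<^sub>R (y - x))"
    by (intro polynomial_function_add polynomial_function_mult) auto
  then have "polynomial_function g"
    unfolding g_def using assms(1) by (rule polynomial_function_compose)
  then have "analytic_path g"
    unfolding analytic_path_def
    by (intro exI[of _ UNIV] exI[of _ g]) (simp add: polynomial_function_real_analytic)
  moreover have "path_image g \<subseteq> f ` B"
  proof -
    have "x + t *\<^sub>R (y - x) \<in> B" if "t \<in> {0..1}" for t
    proof -
      have "x + t *\<^sub>R (y - x) = (1 - t) *\<^sub>R x + t *\<^sub>R y"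
        by (simp add: algebra_simps)
      then show ?thesis
        using convexD_alt[OF assms(2) xy(1,2), of t] that by simp
    qed
    then show ?thesis
      by (auto simp: path_image_def g_def)
  qed
  moreover have "pathstart g = p" "pathfinish g = q"
    by (simp_all add: pathstart_def pathfinish_def g_def xy)
  ultimately show "\<exists>g. analytic_path g \<and> path_image g \<subseteq> f ` B \<and> pathstart g = p \<and> pathfinish g = q"
    by blast
qed

theorem theorem1p4:
  fixes \<P> :: "(real ^ 'n) set set" and S :: "(real ^ 'n) set"
  assumes "finite \<P>" and "\<P> \<noteq> {}"
    and "\<And>P. P \<in> \<P> \<Longrightarrow> polyhedron P \<and> compact P \<and> aff_dim P = int CARD('n)"
    and "S = \<Union>\<P>"
  shows "connected_by_analytic_paths S \<longleftrightarrow>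
    (\<exists>f :: real ^ 'n \<Rightarrow> real ^ 'n. polynomial_function f \<and> f ` cball 0 1 = S)"
proof
  assume "\<exists>f :: real ^ 'n \<Rightarrow> real ^ 'n. polynomial_function f \<and> f ` cball 0 1 = S"
  then show "connected_by_analytic_paths S"
    using polynomial_image_connected_by_analytic_paths[OF _ convex_cball] by blast
next
  assume connected: "connected_by_analytic_paths S"
  have "\<forall>P\<in>\<P>. \<exists>G. finite G \<and> (\<forall>(c, d)\<in>G. c \<noteq> 0) \<and> P = {x. \<forall>(c, d)\<in>G. c \<bullet> x \<le> d}"
    using assms(3) polyhedron_as_halfspaces by blast
  from bchoice[OF this] obtain G where
    G: "\<forall>P\<in>\<P>. finite (G P) \<and> (\<forall>(c, d)\<in>G P. c \<noteq> 0) \<and> P = {x. \<forall>(c, d)\<in>G P. c \<bullet> x \<le> d}"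
    by blast
  \<comment> \<open>All hyperplanes that bound one of the polyhedra; the base points \<open>p P\<close> must avoid them, so
    that no path between base points stays within one of them.\<close>
  define H where "H = (\<Union>P\<in>\<P>. G P)"
  have H: "finite H" "\<And>c d. (c, d) \<in> H \<Longrightarrow> c \<noteq> 0"
    using assms(1) G by (auto simp: H_def)
  have "\<exists>p\<in>interior P. \<forall>(c, d)\<in>H. c \<bullet> p \<noteq> d" if "P \<in> \<P>" for P
  proof (rule exists_interior_point_off_hyperplanes[OF _ H])
    have "convex P" "P \<noteq> {}" "aff_dim P = int DIM(real ^ 'n)"
      using assms(3)[OF that] polyhedron_imp_convex[of P] by auto
    then show "interior P \<noteq> {}"
      using rel_interior_eq_empty[of P] interior_rel_interior_gen[of P] by simp
  qed
  then have "\<forall>P\<in>\<P>. \<exists>p. p \<in> interior P \<and> (\<forall>(c, d)\<in>H. c \<bullet> p \<noteq> d)"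
    by blast
  from bchoice[OF this] obtain p
    where p: "\<forall>P\<in>\<P>. p P \<in> interior P \<and> (\<forall>(c, d)\<in>H. c \<bullet> p P \<noteq> d)"
    by blast
  have subset: "P \<subseteq> S" if "P \<in> \<P>" for P
    using that assms(4) by blast
  have transport: "robustly_swept S (\<chi> k::'n. p P) (\<chi> k. p Q) {}" if PQ: "P \<in> \<P>" "Q \<in> \<P>" for P Q
  proof -
    have "p P \<in> S" "p Q \<in> S"
      using p PQ interior_subset subset by blast+
    then obtain g where g: "analytic_path g" "path_image g \<subseteq> S" "pathstart g = p P" "pathfinish g = p Q"
      using connected unfolding connected_by_analytic_paths_def by blast
    have "robustly_swept S (\<chi> k::'n. pathstart g) (\<chi> k. pathfinish g) {}"
    proof (rule robustly_swept_analytic_path[OF g(1,2) H(1)])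
      show "c \<bullet> pathstart g \<noteq> d \<and> c \<bullet> pathfinish g \<noteq> d" if "(c, d) \<in> H" for c d
        using p PQ that unfolding g by blast
      fix x assume "x \<in> S"
      then obtain P where P: "P \<in> \<P>" "x \<in> P"
        using assms(4) by blast
      have P_eq: "P = {x. \<forall>(c, d)\<in>G P. c \<bullet> x \<le> d}"
        using G P(1) by blast
      show "\<exists>G\<subseteq>H. (\<forall>(c, d)\<in>G. c \<bullet> x \<le> d) \<and> {y. \<forall>(c, d)\<in>G. c \<bullet> y \<le> d} \<subseteq> S"
      proof (intro exI[of _ "G P"] conjI)
        show "G P \<subseteq> H"
          using P(1) by (auto simp: H_def)
        show "\<forall>(c, d)\<in>G P. c \<bullet> x \<le> d"
          using P(2) P_eq by blast
        show "{y. \<forall>(c, d)\<in>G P. c \<bullet> y \<le> d} \<subseteq> S"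
          using subset[OF P(1)] P_eq by blast
      qed
    qed
    then show ?thesis
      by (simp only: g)
  qed
  have "\<forall>P\<in>\<P>. \<exists>C. P \<subseteq> C \<and> robustly_swept S (\<chi> k::'n. p P) (\<chi> k. p P) C"
    using assms(3) p subset by (intro ballI robustly_swept_polytope) auto
  from bchoice[OF this] obtain C
    where C: "\<forall>P\<in>\<P>. P \<subseteq> C P \<and> robustly_swept S (\<chi> k::'n. p P) (\<chi> k. p P) (C P)"
    by blast
  obtain P0 where P0: "P0 \<in> \<P>"
    using assms(2) by blast
  \<comment> \<open>Each polyhedron is covered by a loop at the same base point, so the loops can be composed in
    any order.\<close>
  have loop: "robustly_swept S (\<chi> k::'n. p P0) (\<chi> k. p P0) (C P)" if "P \<in> \<P>" for P
  proof -
    have "robustly_swept S (\<chi> k::'n. p P) (\<chi> k. p P) (C P)"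
      using C that by blast
    from robustly_swept_trans[OF robustly_swept_trans[OF transport[OF P0 that] this] transport[OF that P0]]
    show ?thesis
      by simp
  qed
  have "robustly_swept S (\<chi> k::'n. p P0) (\<chi> k. p P0) (\<Union>P\<in>\<P>. C P)"
    using assms(1) transport[OF P0 P0] loop by (rule robustly_swept_UN)
  then obtain \<gamma> where \<gamma>: "polynomial_function \<gamma>" "\<gamma> 0 = (\<chi> k::'n. p P0)"
    "(\<Union>P\<in>\<P>. C P) \<subseteq> sweep \<gamma> 0 1" "sweep \<gamma> 0 1 \<subseteq> S"
    by (rule robustly_swept_polynomial)
  have "S \<subseteq> (\<Union>P\<in>\<P>. C P)"
    using C assms(4) by blast
  then have "sweep \<gamma> 0 1 = S"
    using \<gamma>(3,4) by blast
  moreover have "\<gamma> 0 $ k = p P0" for k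
    by (simp add: \<gamma>(2))
  ultimately show "\<exists>f :: real ^ 'n \<Rightarrow> real ^ 'n. polynomial_function f \<and> f ` cball 0 1 = S"
    using sweep_eq_image_cball[OF \<gamma>(1)] by metis
qed

end
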